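(* Let $\rho_t$ be the solution of $\partial_t\rho_t=\nabla\cdot(\rho_t\,aa^{\mathsf T}\nabla\log\frac{\rho_t}\pi)$, and write $\delta\mathrm D=\delta\mathrm D(\rho_t)=\log\frac{\rho_t}{\pi}+1$. Then $$\frac{d}{dt}\mathrm I_{a,z}(\rho_t)=-2\int\Big(\Gamma_2(\delta\mathrm D,\delta\mathrm D)+\tilde\Gamma_2^z(\delta\mathrm D,\delta\mathrm D)\Big)\rho_t\,dx,$$ where $$\tilde\Gamma_2^z(\Phi,\Phi)=\tfrac12L(\Gamma_1^z(\Phi,\Phi))-\Gamma_1(L_z\Phi,\Phi),\qquad L_z\Phi=\nabla\cdot(zz^{\mathsf T}\nabla\Phi)+(\nabla\log\pi,zz^{\mathsf T}\nabla\Phi).$$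
   Context: $n,m\ge1$, $a:\mathbb R^{n+m}\to\mathbb R^{(n+m)\times n}$ and $z:\mathbb R^{n+m}\to\mathbb R^{(n+m)\times m}$ are smooth matrix functions, $\pi$ a smooth positive probability density on $\mathbb R^{n+m}$; the columns of $a$ satisfy the strong H\"ormander condition. $\rho_t=\rho(t,\cdot)$ is a smooth strictly positive probability density for each $t$. $Lf=\nabla\cdot(aa^{\mathsf T}\nabla f)+(\nabla\log\pi,aa^{\mathsf T}\nabla f)$ (this is the generator $\nabla\cdot(aa^{\mathsf T}\nabla f)-\langle a\otimes\nabla a,\nabla f\rangle+\langle b,\nabla f\rangle$ under the standing assumption $b=a\otimes\nabla a+aa^{\mathsf T}\nabla\log\pi$, with $(a\otimes\nabla a)_p=\sum_{k,q}a_{pk}\partial_qa_{qk}$). $\Gamma_1(f,g)=\langle a^{\mathsf T}\nabla f,a^{\mathsf T}\nabla g\rangle$, $\Gamma_1^z(f,g)=\langle z^{\mathsf T}\nabla f,z^{\mathsf T}\nabla g\rangle$, $\Gamma_2(f,f)=\frac12L\Gamma_1(f,f)-\Gamma_1(Lf,f)$. $\mathrm D(\rho)=\int\rho\log\frac\rho\pi dx$ and $\delta\mathrm D$ is its $L^2$ first variation. $\mathrm I_{a,z}(\rho)=\int(\nabla\delta\mathrm D,(aa^{\mathsf T}+zz^{\mathsf T})\nabla\delta\mathrm D)\rho\,dx$. All functions are such that the integrals and integrations by parts on $\mathbb R^{n+m}$ make sense without boundary terms (the paper works formally in this respect). *)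

theory Defs
  imports "HOL-Analysis.Analysis"
begin

text \<open>Meaningful for open \<open>S\<close> in a finite-dimensional space: all iterated directional
  derivatives up to order \<open>k\<close> exist as Frechet derivatives and are continuous.\<close>

fun Ck_on :: "nat \<Rightarrow> 'a::euclidean_space set \<Rightarrow> ('a \<Rightarrow> 'b::real_normed_vector) \<Rightarrow> bool" where
  "Ck_on 0 S f \<longleftrightarrow> continuous_on S f"
| "Ck_on (Suc k) S f \<longleftrightarrow>
     (\<forall>x\<in>S. f differentiable (at x)) \<and> (\<forall>v. Ck_on k S (\<lambda>x. frechet_derivative f (at x) v))"

definition smooth_on :: "'a::euclidean_space set \<Rightarrow> ('a \<Rightarrow> 'b::real_normed_vector) \<Rightarrow> bool" where
  "smooth_on S f \<longleftrightarrow> (\<forall>k. Ck_on k S f)"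

definition grad :: "(real^'k \<Rightarrow> real) \<Rightarrow> real^'k \<Rightarrow> real^'k" where
  "grad f x = (\<chi> i. frechet_derivative f (at x) (axis i 1))"

definition divergence :: "(real^'k \<Rightarrow> real^'k) \<Rightarrow> real^'k \<Rightarrow> real" where
  "divergence V x = (\<Sum>i\<in>UNIV. frechet_derivative (\<lambda>y. V y $ i) (at x) (axis i 1))"


subsection \<open>The strong Hoermander condition\<close>

definition lie_bracket :: "(real^'k \<Rightarrow> real^'k) \<Rightarrow> (real^'k \<Rightarrow> real^'k) \<Rightarrow> real^'k \<Rightarrow> real^'k" where
  "lie_bracket X Y x = frechet_derivative Y (at x) (X x) - frechet_derivative X (at x) (Y x)"

inductive_set iterated_brackets :: "(real^'k \<Rightarrow> real^'k) set \<Rightarrow> (real^'k \<Rightarrow> real^'k) set"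
  for F where
  generator: "X \<in> F \<Longrightarrow> X \<in> iterated_brackets F"
| bracket: "X \<in> iterated_brackets F \<Longrightarrow> Y \<in> iterated_brackets F \<Longrightarrow>
    lie_bracket X Y \<in> iterated_brackets F"

text \<open>``Strong'': only the diffusion fields (the columns of \<open>a\<close>) and their brackets are used,
  not the drift.\<close>

definition strong_hormander :: "(real^'k \<Rightarrow> real^'n^'k) \<Rightarrow> bool" where
  "strong_hormander a \<longleftrightarrow>
     (\<forall>x. span {X x |X. X \<in> iterated_brackets (range (\<lambda>j y. column j (a y)))} = UNIV)"


subsection \<open>Generators and Gamma operators\<close>

text \<open>With \<open>\<sigma> = a\<close> this is the generator \<open>L\<close>, with \<open>\<sigma> = z\<close> it is \<open>L\<^sub>z\<close>.
  The drift \<open>b\<close> of the diffusion is already eliminated through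
  \<open>b = a \<otimes> \<nabla>a + a a\<^sup>T \<nabla> log \<pi>\<close>.\<close>

definition gen :: "(real^'k \<Rightarrow> real^'r^'k) \<Rightarrow> (real^'k \<Rightarrow> real) \<Rightarrow> (real^'k \<Rightarrow> real) \<Rightarrow> real^'k \<Rightarrow> real" where
  "gen \<sigma> \<pi> f x =
     divergence (\<lambda>y. (\<sigma> y ** transpose (\<sigma> y)) *v grad f y) x
     + grad (\<lambda>y. ln (\<pi> y)) x \<bullet> ((\<sigma> x ** transpose (\<sigma> x)) *v grad f x)"

text \<open>With \<open>\<sigma> = a\<close> this is \<open>\<Gamma>\<^sub>1\<close>, with \<open>\<sigma> = z\<close> it is \<open>\<Gamma>\<^sub>1\<^sup>z\<close>.\<close>

definition Gamma1 :: "(real^'k \<Rightarrow> real^'r^'k) \<Rightarrow> (real^'k \<Rightarrow> real) \<Rightarrow> (real^'k \<Rightarrow> real) \<Rightarrow> real^'k \<Rightarrow> real" where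
  "Gamma1 \<sigma> f g x = (transpose (\<sigma> x) *v grad f x) \<bullet> (transpose (\<sigma> x) *v grad g x)"

definition Gamma2 :: "(real^'k \<Rightarrow> real^'n^'k) \<Rightarrow> (real^'k \<Rightarrow> real) \<Rightarrow> (real^'k \<Rightarrow> real) \<Rightarrow> real^'k \<Rightarrow> real" where
  "Gamma2 a \<pi> f x = 1/2 * gen a \<pi> (Gamma1 a f f) x - Gamma1 a (gen a \<pi> f) f x"

text \<open>The mixed operator \<open>\<Gamma>\<^sub>2\<^sup>z\<close> (with tilde): the outer \<open>L\<close> and \<open>\<Gamma>\<^sub>1\<close> are those of \<open>a\<close>.\<close>

definition Gamma2z :: "(real^'k \<Rightarrow> real^'n^'k) \<Rightarrow> (real^'k \<Rightarrow> real^'m^'k) \<Rightarrow> (real^'k \<Rightarrow> real) \<Rightarrow>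
    (real^'k \<Rightarrow> real) \<Rightarrow> real^'k \<Rightarrow> real" where
  "Gamma2z a z \<pi> f x = 1/2 * gen a \<pi> (Gamma1 z f f) x - Gamma1 a (gen z \<pi> f) f x"


subsection \<open>Relative entropy, its first variation, and the Fisher information\<close>

definition rel_entropy :: "('a::euclidean_space \<Rightarrow> real) \<Rightarrow> ('a \<Rightarrow> real) \<Rightarrow> real" where
  "rel_entropy \<pi> \<rho> = (LINT x|lborel. \<rho> x * ln (\<rho> x / \<pi> x))"

definition L2_first_variation ::
    "(('a::euclidean_space \<Rightarrow> real) \<Rightarrow> real) \<Rightarrow> ('a \<Rightarrow> real) \<Rightarrow> ('a \<Rightarrow> real) \<Rightarrow> bool" where
  "L2_first_variation E \<rho> \<phi> \<longleftrightarrow>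
     (\<forall>\<eta>. continuous_on UNIV \<eta> \<and> bounded {x. \<eta> x \<noteq> 0} \<longrightarrow>
        ((\<lambda>\<epsilon>. E (\<lambda>x. \<rho> x + \<epsilon> * \<eta> x)) has_real_derivative (LINT x|lborel. \<phi> x * \<eta> x)) (at 0))"

definition dD :: "('a \<Rightarrow> real) \<Rightarrow> ('a \<Rightarrow> real) \<Rightarrow> 'a \<Rightarrow> real" where
  "dD \<pi> \<rho> x = ln (\<rho> x / \<pi> x) + 1"

lemma dD_is_first_variation:
  fixes \<pi> \<rho> :: "'a::euclidean_space \<Rightarrow> real"
  assumes "continuous_on UNIV \<pi>" "continuous_on UNIV \<rho>"
    and pos: "\<And>x. \<pi> x > 0" "\<And>x. \<rho> x > 0"
    and int: "integrable lborel (\<lambda>x. \<rho> x * ln (\<rho> x / \<pi> x))"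
  shows "L2_first_variation (rel_entropy \<pi>) \<rho> (dD \<pi> \<rho>)"
  unfolding L2_first_variation_def
proof (intro allI impI)
  fix \<eta> :: "'a \<Rightarrow> real"
  assume "continuous_on UNIV \<eta> \<and> bounded {x. \<eta> x \<noteq> 0}"
  then have cont\<eta>: "continuous_on UNIV \<eta>" and bdd: "bounded {x. \<eta> x \<noteq> 0}" by auto
  have [continuous_intros]: "continuous_on S \<pi>" "continuous_on S \<rho>" "continuous_on S \<eta>" for S
    using assms(1,2) cont\<eta> continuous_on_subset by blast+
  obtain c where "{x. \<eta> x \<noteq> 0} \<subseteq> cbox (-c) c"
    using bounded_subset_cbox_symmetric[OF bdd] by blast
  moreover define K where "K = cbox (-c) c"
  ultimately have supp: "\<eta> x = 0" if "x \<notin> K" for x using that by auto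
  have "compact K" by (simp add: K_def)
  obtain M where "M > 0" and M: "\<And>x. x \<in> K \<Longrightarrow> \<bar>\<eta> x / \<rho> x\<bar> \<le> M"
  proof -
    have "continuous_on K (\<lambda>x. \<eta> x / \<rho> x)"
      using pos by (intro continuous_intros) (auto simp: less_imp_neq[THEN not_sym])
    then have "bounded ((\<lambda>x. \<eta> x / \<rho> x) ` K)"
      using \<open>compact K\<close> compact_continuous_image compact_imp_bounded by blast
    then show ?thesis using that unfolding bounded_pos by auto
  qed
  define U where "U = {-1/M<..<1/M}"
  have U: "open U" "convex U" "0 \<in> U" using \<open>M > 0\<close> by (auto simp: U_def)
  have pos': "\<rho> x + \<epsilon> * \<eta> x > 0" if "\<epsilon> \<in> U" "x \<in> K" for \<epsilon> x
  proof -
    have "\<bar>\<epsilon> * (\<eta> x / \<rho> x)\<bar> = \<bar>\<epsilon>\<bar> * \<bar>\<eta> x / \<rho> x\<bar>" by (simp add: abs_mult)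
    also have "\<dots> \<le> \<bar>\<epsilon>\<bar> * M" using M[OF that(2)] by (intro mult_left_mono) auto
    also have "\<dots> < 1" using that(1) \<open>M > 0\<close> by (auto simp: U_def field_simps abs_if)
    finally have "0 < 1 + \<epsilon> * (\<eta> x / \<rho> x)" by linarith
    then have "0 < \<rho> x * (1 + \<epsilon> * (\<eta> x / \<rho> x))"
      using pos(2) mult_pos_pos by blast
    moreover have "\<rho> x * (1 + \<epsilon> * (\<eta> x / \<rho> x)) = \<rho> x + \<epsilon> * \<eta> x"
      using pos(2)[of x] by (simp add: distrib_left)
    ultimately show ?thesis by simp
  qed
  define H where "H \<epsilon> x = (\<rho> x + \<epsilon> * \<eta> x) * ln ((\<rho> x + \<epsilon> * \<eta> x) / \<pi> x) - \<rho> x * ln (\<rho> x / \<pi> x)" for \<epsilon> x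
  define H' where "H' \<epsilon> x = \<eta> x * (ln ((\<rho> x + \<epsilon> * \<eta> x) / \<pi> x) + 1)" for \<epsilon> x
  have nz: "\<pi> x \<noteq> 0" "\<rho> x \<noteq> 0" for x using pos[of x] by auto
  have lnz: "\<epsilon> \<in> U \<Longrightarrow> x \<in> K \<Longrightarrow> \<rho> x + \<epsilon> * \<eta> x \<noteq> 0" for \<epsilon> x using pos'[of \<epsilon> x] by auto
  have contH: "continuous_on K (H \<epsilon>)" if "\<epsilon> \<in> U" for \<epsilon>
    unfolding H_def using that nz lnz by (intro continuous_intros) auto
  have contH': "continuous_on (U \<times> K) (\<lambda>(\<epsilon>, x). H' \<epsilon> x)"
  proof -
    have [continuous_intros]: "continuous_on (U \<times> K) (\<lambda>p. \<pi> (snd p))"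
      "continuous_on (U \<times> K) (\<lambda>p. \<rho> (snd p))" "continuous_on (U \<times> K) (\<lambda>p. \<eta> (snd p))"
      by (rule continuous_on_compose2[OF _ continuous_on_snd[OF continuous_on_id] subset_UNIV],
          rule assms cont\<eta>)+
    show ?thesis unfolding H'_def split_beta using nz lnz
      by (intro continuous_intros) (auto simp: mem_Times_iff)
  qed
  have H'0: "H' 0 x = dD \<pi> \<rho> x * \<eta> x" for x by (simp add: H'_def dD_def)
  have onK: "integrable lborel f \<and> (LINT x|lborel. f x) = integral K f"
    if "continuous_on K f" "\<And>x. x \<notin> K \<Longrightarrow> f x = 0" for f :: "'a \<Rightarrow> real"
  proof -
    have "set_integrable lborel K f"
      using borel_integrable_compact[OF \<open>compact K\<close> that(1)] by (simp add: set_integrable_def)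
    moreover have "(\<lambda>x. indicator K x *\<^sub>R f x) = f"
    proof
      show "indicator K x *\<^sub>R f x = f x" for x
        using that(2)[of x] by (cases "x \<in> K") auto
    qed
    ultimately show ?thesis
      using set_borel_integral_eq_integral[of K f] by (simp add: set_integrable_def set_lebesgue_integral_def)
  qed
  have "((\<lambda>\<epsilon>. integral K (H \<epsilon>)) has_real_derivative integral K (H' 0)) (at 0 within U)"
    unfolding K_def
  proof (rule leibniz_rule_field_derivative)
    show "((\<lambda>\<epsilon>. H \<epsilon> x) has_field_derivative H' \<epsilon> x) (at \<epsilon> within U)"
      if "\<epsilon> \<in> U" "x \<in> cbox (-c) c" for \<epsilon> x
    proof -
      define w where "w = \<rho> x + \<epsilon> * \<eta> x"
      have w: "w > 0" "w / \<pi> x > 0" "\<pi> x > 0"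
        using pos'[of \<epsilon> x] that pos[of x] by (auto simp: w_def K_def)
      have "((\<lambda>\<epsilon>. \<rho> x + \<epsilon> * \<eta> x) has_field_derivative \<eta> x) (at \<epsilon> within U)"
        by (auto intro!: derivative_eq_intros)
      moreover from this have "((\<lambda>\<epsilon>. (\<rho> x + \<epsilon> * \<eta> x) / \<pi> x) has_field_derivative \<eta> x / \<pi> x) (at \<epsilon> within U)"
        by (rule DERIV_cdivide)
      ultimately have "((\<lambda>\<epsilon>. (\<rho> x + \<epsilon> * \<eta> x) * ln ((\<rho> x + \<epsilon> * \<eta> x) / \<pi> x)) has_field_derivative
          \<eta> x * ln (w / \<pi> x) + 1 / (w / \<pi> x) * (\<eta> x / \<pi> x) * w) (at \<epsilon> within U)"
        unfolding w_def using w by (intro DERIV_mult DERIV_ln_divide[THEN DERIV_chain2]) (auto simp: w_def)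
      moreover have "\<eta> x * ln (w / \<pi> x) + 1 / (w / \<pi> x) * (\<eta> x / \<pi> x) * w = H' \<epsilon> x"
        using w by (simp add: H'_def w_def[symmetric] distrib_left)
      ultimately have "((\<lambda>\<epsilon>. (\<rho> x + \<epsilon> * \<eta> x) * ln ((\<rho> x + \<epsilon> * \<eta> x) / \<pi> x)) has_field_derivative
          H' \<epsilon> x) (at \<epsilon> within U)" by (simp only:)
      from DERIV_diff[OF this DERIV_const[of "\<rho> x * ln (\<rho> x / \<pi> x)"]]
      show ?thesis unfolding H_def by (simp only: diff_0_right)
    qed
    show "H \<epsilon> integrable_on cbox (-c) c" if "\<epsilon> \<in> U" for \<epsilon>
      using contH[OF that] integrable_continuous by (auto simp: K_def)
  qed (use contH' U in \<open>simp_all add: K_def\<close>)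
  also have "integral K (H' 0) = (LINT x|lborel. dD \<pi> \<rho> x * \<eta> x)"
  proof -
    have "continuous_on K (H' 0)" unfolding H'_def using nz by (intro continuous_intros) auto
    then show ?thesis using onK[of "H' 0"] supp by (auto simp: H'0)
  qed
  finally have der: "((\<lambda>\<epsilon>. rel_entropy \<pi> \<rho> + integral K (H \<epsilon>)) has_real_derivative
      (LINT x|lborel. dD \<pi> \<rho> x * \<eta> x)) (at 0)"
    using DERIV_add[OF DERIV_const[of "rel_entropy \<pi> \<rho>"]] U(1,3) at_within_open[of 0 U] by fastforce
  have eq: "rel_entropy \<pi> \<rho> + integral K (H \<epsilon>) = rel_entropy \<pi> (\<lambda>x. \<rho> x + \<epsilon> * \<eta> x)" if "\<epsilon> \<in> U" for \<epsilon>
  proof -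
    have H: "integrable lborel (H \<epsilon>)" "(LINT x|lborel. H \<epsilon> x) = integral K (H \<epsilon>)"
      using onK[OF contH[OF that]] supp by (auto simp: H_def)
    have "rel_entropy \<pi> (\<lambda>x. \<rho> x + \<epsilon> * \<eta> x) = (LINT x|lborel. \<rho> x * ln (\<rho> x / \<pi> x) + H \<epsilon> x)"
      by (simp add: rel_entropy_def H_def)
    also have "\<dots> = rel_entropy \<pi> \<rho> + integral K (H \<epsilon>)"
      using int H by (simp add: rel_entropy_def)
    finally show ?thesis by simp
  qed
  show "((\<lambda>\<epsilon>. rel_entropy \<pi> (\<lambda>x. \<rho> x + \<epsilon> * \<eta> x)) has_real_derivative
      (LINT x|lborel. dD \<pi> \<rho> x * \<eta> x)) (at 0)"
    using has_field_derivative_transform_within_open[OF der U(1,3) eq] .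
qed

definition fisher_density :: "(real^'k \<Rightarrow> real^'n^'k) \<Rightarrow> (real^'k \<Rightarrow> real^'m^'k) \<Rightarrow> (real^'k \<Rightarrow> real) \<Rightarrow>
    (real^'k \<Rightarrow> real) \<Rightarrow> real^'k \<Rightarrow> real" where
  "fisher_density a z \<pi> \<rho> x =
     (grad (dD \<pi> \<rho>) x \<bullet>
       ((a x ** transpose (a x) + z x ** transpose (z x)) *v grad (dD \<pi> \<rho>) x)) * \<rho> x"

definition fisher_info :: "(real^'k \<Rightarrow> real^'n^'k) \<Rightarrow> (real^'k \<Rightarrow> real^'m^'k) \<Rightarrow> (real^'k \<Rightarrow> real) \<Rightarrow>
    (real^'k \<Rightarrow> real) \<Rightarrow> real" where
  "fisher_info a z \<pi> \<rho> = (LINT x|lborel. fisher_density a z \<pi> \<rho> x)"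


subsection \<open>Integration by parts without boundary terms\<close>

text \<open>In polar coordinates the expression below is the average, over radii \<open>r \<in> [R, 2R]\<close>, of the
  flux of \<open>V\<close> through the sphere \<open>|x| = r\<close>.\<close>

definition no_flux_at_infinity :: "('a::euclidean_space \<Rightarrow> 'a) \<Rightarrow> bool" where
  "no_flux_at_infinity V \<longleftrightarrow>
     ((\<lambda>R. (LINT x:{x. R \<le> norm x \<and> norm x \<le> 2 * R}|lborel. V x \<bullet> sgn x) / R) \<longlongrightarrow> 0) at_top"

text \<open>Both integrals in \<open>\<integral> f (\<nabla>\<cdot>V) = - \<integral> (\<nabla>f, V)\<close> converge and the boundary term, i.e. the flux of
  \<open>f V\<close> through large spheres, vanishes. The identity itself is not assumed.\<close>

definition ibp_admissible :: "(real^'k \<Rightarrow> real) \<Rightarrow> (real^'k \<Rightarrow> real^'k) \<Rightarrow> bool" where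
  "ibp_admissible f V \<longleftrightarrow>
     integrable lborel (\<lambda>x. f x * divergence V x) \<and>
     integrable lborel (\<lambda>x. grad f x \<bullet> V x) \<and>
     no_flux_at_infinity (\<lambda>x. f x *\<^sub>R V x)"

end

theory Submission
  imports Defs
begin

text \<open>Write \<open>\<phi> = \<delta>D\<close>, \<open>A = a a\<^sup>T\<close>, \<open>Z = z z\<^sup>T\<close> and \<open>h = \<partial>\<^sub>t \<phi>\<close>. Since
  \<open>\<nabla>\<cdot>(\<rho> A \<nabla>\<phi>) = \<rho> (L \<phi> + \<Gamma>\<^sub>1(\<phi>, \<phi>))\<close>, the flow equation reads
  \<open>h = L \<phi> + \<Gamma>\<^sub>1(\<phi>, \<phi>)\<close>. Differentiating the Fisher information under the integral gives
  \<open>\<integral> 2 (\<nabla>h, (A + Z) \<nabla>\<phi>) \<rho> + (\<nabla>\<phi>, (A + Z) \<nabla>\<phi>) \<nabla>\<cdot>(\<rho> A \<nabla>\<phi>)\<close>. The point is the mixed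
  term: integrating by parts twice moves the roles of \<open>a\<close> and \<open>z\<close>,
  \<open>\<integral> (\<nabla>h, Z \<nabla>\<phi>) \<rho> = - \<integral> h \<nabla>\<cdot>(\<rho> Z \<nabla>\<phi>) = - \<integral> (L\<^sub>z \<phi> + \<Gamma>\<^sub>1\<^sup>z(\<phi>, \<phi>)) \<nabla>\<cdot>(\<rho> A \<nabla>\<phi>)
  = \<integral> \<Gamma>\<^sub>1(L\<^sub>z \<phi> + \<Gamma>\<^sub>1\<^sup>z(\<phi>, \<phi>), \<phi>) \<rho>\<close>,
  because \<open>h \<rho> = \<nabla>\<cdot>(\<rho> A \<nabla>\<phi>)\<close>. Finally
  \<open>\<integral> \<Gamma>\<^sub>1(f, \<phi>) \<rho> = - \<integral> (L f) \<rho>\<close> turns the remaining first-order terms into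
  the terms \<open>L \<Gamma>\<^sub>1\<close> and \<open>L \<Gamma>\<^sub>1\<^sup>z\<close>.\<close>

subsection \<open>Smooth functions\<close>

lemma Ck_on_has_derivative:
  assumes "Ck_on (Suc k) S f" "x \<in> S"
  shows "(f has_derivative frechet_derivative f (at x)) (at x)"
proof -
  have "f differentiable (at x)" using assms by simp
  then show ?thesis by (rule frechet_derivative_works[THEN iffD1])
qed

text \<open>On an open set the derivative at a point depends only on values inside the set, so
  agreement on \<open>S\<close> passes to all directional derivatives and the induction applies to
  these.\<close>

lemma Ck_on_cong:
  assumes "open S" "\<And>x. x \<in> S \<Longrightarrow> f x = g x" "Ck_on k S f"
  shows "Ck_on k S g"
  using assms(2,3)
proof (induction k arbitrary: f g)
  case 0
  then show ?case using continuous_on_cong[of S S f g] by simp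
next
  case (Suc k)
  have d: "(g has_derivative frechet_derivative f (at x)) (at x)" if "x \<in> S" for x
    using has_derivative_transform_within_open[OF Ck_on_has_derivative[OF Suc.prems(2) that] assms(1) that]
      Suc.prems(1) by blast
  have eq: "frechet_derivative f (at x) v = frechet_derivative g (at x) v" if "x \<in> S" for x v
    using frechet_derivative_at[OF d[OF that]] by simp
  have "Ck_on k S (\<lambda>x. frechet_derivative f (at x) v)" for v
    using Suc.prems(2) by simp
  then have "Ck_on k S (\<lambda>x. frechet_derivative g (at x) v)" for v
    using Suc.IH[of "\<lambda>x. frechet_derivative f (at x) v" "\<lambda>x. frechet_derivative g (at x) v"] eq by blast
  moreover have "\<forall>x\<in>S. g differentiable (at x)"
    using d differentiableI by blast
  ultimately show ?case by simp
qed

lemma Ck_on_SucD: "Ck_on (Suc k) S f \<Longrightarrow> Ck_on k S f"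
proof (induction k arbitrary: f)
  case 0
  then show ?case
    by (auto intro!: differentiable_imp_continuous_on simp: differentiable_on_def differentiable_at_withinI)
next
  case (Suc k)
  have "Ck_on (Suc k) S (\<lambda>x. frechet_derivative f (at x) v)" for v
    using Suc.prems by (subst (asm) Ck_on.simps) blast
  with Suc.IH Suc.prems show ?case by auto
qed

text \<open>Lets an explicit derivative formula stand in for \<open>frechet_derivative\<close>; the
  closure proofs below take it from the usual differentiation rules.\<close>

lemma Ck_on_SucI:
  assumes "open S" "\<And>x. x \<in> S \<Longrightarrow> (f has_derivative f' x) (at x)"
    "\<And>v. Ck_on k S (\<lambda>x. f' x v)"
  shows "Ck_on (Suc k) S f"
proof -
  have "f' x v = frechet_derivative f (at x) v" if "x \<in> S" for x v
    using frechet_derivative_at[OF assms(2)[OF that]] by simp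
  then have "Ck_on k S (\<lambda>x. frechet_derivative f (at x) v)" for v
    by (rule Ck_on_cong[OF assms(1) _ assms(3)[of v]])
  moreover have "\<forall>x\<in>S. f differentiable (at x)"
    using assms(2) differentiableI by blast
  ultimately show ?thesis by simp
qed

lemma Ck_on_const: "Ck_on k S (\<lambda>x. c)"
  by (induction k arbitrary: c) auto

lemma Ck_on_add:
  assumes "open S" "Ck_on k S f" "Ck_on k S g"
  shows "Ck_on k S (\<lambda>x. f x + g x)"
  using assms(2,3)
proof (induction k arbitrary: f g)
  case 0
  then show ?case by (auto intro: continuous_intros)
next
  case (Suc k)
  then show ?case
    by (intro Ck_on_SucI[OF assms(1) has_derivative_add[OF Ck_on_has_derivative Ck_on_has_derivative]] Suc.IH)
       auto
qed

text \<open>The product rule pairs a derivative of one factor with the other factor itself, so the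
  induction ranges over all pairs and \<open>Ck_on_SucD\<close> lowers the order of the
  undifferentiated factor.\<close>

lemma Ck_on_mult:
  fixes f g :: "'a::euclidean_space \<Rightarrow> real"
  assumes "open S" "Ck_on k S f" "Ck_on k S g"
  shows "Ck_on k S (\<lambda>x. f x * g x)"
  using assms(2,3)
proof (induction k arbitrary: f g)
  case 0
  then show ?case by (auto intro: continuous_intros)
next
  case (Suc k)
  show ?case
  proof (rule Ck_on_SucI[OF assms(1)])
    show "((\<lambda>x. f x * g x) has_derivative
        (\<lambda>v. f x * frechet_derivative g (at x) v + frechet_derivative f (at x) v * g x)) (at x)"
      if "x \<in> S" for x
      using Suc.prems that by (intro has_derivative_mult) (auto intro!: Ck_on_has_derivative)
    show "Ck_on k S (\<lambda>x. f x * frechet_derivative g (at x) v + frechet_derivative f (at x) v * g x)" for v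
      using Suc.prems Suc.prems[THEN Ck_on_SucD]
      by (intro Ck_on_add[OF assms(1)] Suc.IH) auto
  qed
qed

text \<open>The derivative of the reciprocal contains, besides a derivative of \<open>f\<close>,
  only that same reciprocal, so the induction hypothesis for the fixed \<open>f\<close>
  suffices.\<close>

lemma Ck_on_inverse:
  fixes f :: "'a::euclidean_space \<Rightarrow> real"
  assumes "open S" "\<And>x. x \<in> S \<Longrightarrow> f x \<noteq> 0" "Ck_on k S f"
  shows "Ck_on k S (\<lambda>x. inverse (f x))"
  using assms(3)
proof (induction k)
  case 0
  then show ?case using assms(2) by (auto intro: continuous_intros)
next
  case (Suc k)
  show ?case
  proof (rule Ck_on_SucI[OF assms(1)])
    show "((\<lambda>x. inverse (f x)) has_derivative
        (\<lambda>v. (-1) * (inverse (f x) * frechet_derivative f (at x) v * inverse (f x)))) (at x)"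
      if "x \<in> S" for x
      using Deriv.has_derivative_inverse[OF assms(2)[OF that] Ck_on_has_derivative[OF Suc.prems that]] by simp
    show "Ck_on k S (\<lambda>x. (-1) * (inverse (f x) * frechet_derivative f (at x) v * inverse (f x)))" for v
      using Suc.prems Suc.IH[OF Ck_on_SucD[OF Suc.prems]]
      by (intro Ck_on_mult[OF assms(1)] Ck_on_const) auto
  qed
qed

text \<open>One differentiation removes the logarithm, so a case distinction on \<open>k\<close> and
  the rules for products and inverses suffice.\<close>

lemma Ck_on_ln:
  fixes f :: "'a::euclidean_space \<Rightarrow> real"
  assumes "open S" "\<And>x. x \<in> S \<Longrightarrow> f x > 0" "Ck_on k S f"
  shows "Ck_on k S (\<lambda>x. ln (f x))"
proof (cases k)
  case 0
  then show ?thesis using assms(2,3) by (auto intro!: continuous_intros) force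
next
  case (Suc l)
  show ?thesis unfolding Suc
  proof (rule Ck_on_SucI[OF assms(1)])
    show "((\<lambda>x. ln (f x)) has_derivative (\<lambda>v. frechet_derivative f (at x) v * inverse (f x))) (at x)"
      if "x \<in> S" for x
      using assms(2)[OF that] Ck_on_has_derivative[OF assms(3)[unfolded Suc] that]
      by (auto intro!: derivative_eq_intros simp: field_simps)
    have "f x \<noteq> 0" if "x \<in> S" for x using assms(2)[OF that] by simp
    then show "Ck_on l S (\<lambda>x. frechet_derivative f (at x) v * inverse (f x))" for v
      using assms(3) Ck_on_SucD[OF assms(3)[unfolded Suc]] Suc
      by (intro Ck_on_mult[OF assms(1)] Ck_on_inverse[OF assms(1)]) auto
  qed
qed

lemma Ck_on_bounded_linear:
  assumes "open S" "bounded_linear h" "Ck_on k S f"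
  shows "Ck_on k S (\<lambda>x. h (f x))"
  using assms(3)
proof (induction k arbitrary: f)
  case 0
  then show ?case by (simp add: bounded_linear.continuous_on[OF assms(2)])
next
  case (Suc k)
  then show ?case
    by (intro Ck_on_SucI[OF assms(1) bounded_linear.has_derivative[OF assms(2) Ck_on_has_derivative]]) auto
qed

text \<open>The embedding of space at time \<open>t\<close> has derivative \<open>(0, v)\<close> in
  direction \<open>v\<close>, so derivatives of a slice are slices of derivatives.\<close>

lemma Ck_on_slice:
  fixes f :: "'a::euclidean_space \<times> 'b::euclidean_space \<Rightarrow> 'c::real_normed_vector"
  assumes "open T" "Ck_on k (S \<times> T) f" "t \<in> S"
  shows "Ck_on k T (\<lambda>x. f (t, x))"
  using assms(2)
proof (induction k arbitrary: f)
  case 0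
  then show ?case using assms(3)
    by (auto intro!: continuous_on_compose2[of "S \<times> T" f T "\<lambda>x. (t, x)"] continuous_intros)
next
  case (Suc k)
  show ?case
  proof (rule Ck_on_SucI[OF assms(1)])
    show "((\<lambda>x. f (t, x)) has_derivative (\<lambda>v. frechet_derivative f (at (t, x)) (0, v))) (at x)"
      if "x \<in> T" for x
    proof -
      have "(Pair t has_derivative (\<lambda>v. (0, v))) (at x)"
        by (auto intro!: derivative_eq_intros)
      from has_derivative_compose[OF this Ck_on_has_derivative[OF Suc.prems]] that assms(3)
      show ?thesis by simp
    qed
    show "Ck_on k T (\<lambda>x. frechet_derivative f (at (t, x)) (0, v))" for v
      using Suc.prems by (intro Suc.IH) auto
  qed
qed

section \<open>Closure properties of smooth functions\<close>

lemma smooth_on_continuous_on: "smooth_on S f \<Longrightarrow> continuous_on S f"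
  unfolding smooth_on_def using Ck_on.simps(1) by blast

lemma smooth_on_has_derivative:
  "smooth_on S f \<Longrightarrow> x \<in> S \<Longrightarrow> (f has_derivative frechet_derivative f (at x)) (at x)"
  unfolding smooth_on_def using Ck_on_has_derivative by blast

lemma smooth_on_frechet_derivative:
  "smooth_on S f \<Longrightarrow> smooth_on S (\<lambda>x. frechet_derivative f (at x) v)"
  unfolding smooth_on_def using Ck_on.simps(2) by blast

lemma smooth_on_const: "smooth_on S (\<lambda>x. c)"
  unfolding smooth_on_def using Ck_on_const by blast

lemma smooth_on_add:
  "open S \<Longrightarrow> smooth_on S f \<Longrightarrow> smooth_on S g \<Longrightarrow> smooth_on S (\<lambda>x. f x + g x)"
  unfolding smooth_on_def using Ck_on_add by blast

lemma smooth_on_mult: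
  fixes f g :: "'a::euclidean_space \<Rightarrow> real"
  shows "open S \<Longrightarrow> smooth_on S f \<Longrightarrow> smooth_on S g \<Longrightarrow> smooth_on S (\<lambda>x. f x * g x)"
  unfolding smooth_on_def using Ck_on_mult by blast

lemma smooth_on_divide:
  fixes f g :: "'a::euclidean_space \<Rightarrow> real"
  shows "open S \<Longrightarrow> (\<And>x. x \<in> S \<Longrightarrow> g x \<noteq> 0) \<Longrightarrow> smooth_on S f \<Longrightarrow> smooth_on S g \<Longrightarrow>
    smooth_on S (\<lambda>x. f x / g x)"
  unfolding smooth_on_def divide_inverse using Ck_on_mult Ck_on_inverse by blast

lemma smooth_on_ln:
  fixes f :: "'a::euclidean_space \<Rightarrow> real"
  shows "open S \<Longrightarrow> (\<And>x. x \<in> S \<Longrightarrow> f x > 0) \<Longrightarrow> smooth_on S f \<Longrightarrow> smooth_on S (\<lambda>x. ln (f x))"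
  unfolding smooth_on_def using Ck_on_ln by blast

lemma smooth_on_bounded_linear:
  "open S \<Longrightarrow> bounded_linear h \<Longrightarrow> smooth_on S f \<Longrightarrow> smooth_on S (\<lambda>x. h (f x))"
  unfolding smooth_on_def using Ck_on_bounded_linear by blast

lemma smooth_on_sum:
  "open S \<Longrightarrow> (\<And>i. i \<in> A \<Longrightarrow> smooth_on S (f i)) \<Longrightarrow> smooth_on S (\<lambda>x. \<Sum>i\<in>A. f i x)"
  by (induction A rule: infinite_finite_induct) (simp_all add: smooth_on_const smooth_on_add)

lemma smooth_on_slice:
  fixes f :: "'a::euclidean_space \<times> 'b::euclidean_space \<Rightarrow> 'c::real_normed_vector"
  shows "open T \<Longrightarrow> smooth_on (S \<times> T) f \<Longrightarrow> t \<in> S \<Longrightarrow> smooth_on T (\<lambda>x. f (t, x))"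
  unfolding smooth_on_def using Ck_on_slice by blast

text \<open>Lifts the time-independent \<pi> to space-time, where it is combined with the jointly
  smooth \<rho>.\<close>

lemma smooth_on_snd:
  fixes f :: "'b::euclidean_space \<Rightarrow> 'c::real_normed_vector"
  assumes "open S" "open T" "smooth_on T f"
  shows "smooth_on (S \<times> T) (\<lambda>p::'a::euclidean_space \<times> 'b. f (snd p))"
proof -
  have "Ck_on k (S \<times> T) (\<lambda>p. f (snd p))" if "Ck_on k T f" for k and f :: "'b \<Rightarrow> 'c"
    using that
  proof (induction k arbitrary: f)
    case 0
    then show ?case by (auto intro!: continuous_on_compose2[of T f] continuous_intros)
  next
    case (Suc k)
    show ?case
    proof (rule Ck_on_SucI)
      show "((\<lambda>p. f (snd p)) has_derivative (\<lambda>v. frechet_derivative f (at (snd p)) (snd v))) (at p)"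
        if "p \<in> S \<times> T" for p
        using that Ck_on_has_derivative[OF Suc.prems, of "snd p"]
        by (intro has_derivative_compose[OF has_derivative_snd[OF has_derivative_ident]]) auto
    qed (use Suc assms in \<open>auto intro: open_Times\<close>)
  qed
  with assms(3) show ?thesis by (simp add: smooth_on_def)
qed

section \<open>Symmetry of mixed second derivatives\<close>

lemma has_derivative_line:
  fixes f :: "'a::real_normed_vector \<Rightarrow> real"
  assumes D: "(f has_derivative D) (at (x + s *\<^sub>R v))"
  shows "((\<lambda>s. f (x + s *\<^sub>R v)) has_real_derivative D v) (at s)"
proof -
  have "((\<lambda>s. x + s *\<^sub>R v) has_derivative (\<lambda>h. h *\<^sub>R v)) (at s)"
    by (auto intro!: derivative_eq_intros)
  from has_derivative_compose[OF this D]
  have "((\<lambda>s. f (x + s *\<^sub>R v)) has_derivative (\<lambda>h. D (h *\<^sub>R v))) (at s)" .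
  moreover have "D (h *\<^sub>R v) = D v * h" for h
    using linear_cmul[OF has_derivative_linear[OF D]] by simp
  ultimately show ?thesis by (simp add: has_field_derivative_def)
qed

lemma smooth_on_has_real_derivative_line:
  fixes f :: "'a::euclidean_space \<Rightarrow> real"
  assumes "smooth_on S f" "x + s *\<^sub>R v \<in> S"
  shows "((\<lambda>s. f (x + s *\<^sub>R v)) has_real_derivative frechet_derivative f (at (x + s *\<^sub>R v)) v) (at s)"
  by (rule has_derivative_line[OF smooth_on_has_derivative[OF assms]])

text \<open>The mean value theorem, applied in each of the two directions, writes the second difference of
  \<open>f\<close> as a mixed derivative at a nearby point.\<close>

lemma second_difference_mvt:
  fixes f :: "'a::euclidean_space \<Rightarrow> real"
  assumes f: "smooth_on S f" and h: "0 < h"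
    and S: "\<And>s r. 0 \<le> s \<Longrightarrow> s \<le> h \<Longrightarrow> 0 \<le> r \<Longrightarrow> r \<le> h \<Longrightarrow> x + s *\<^sub>R u + r *\<^sub>R v \<in> S"
  obtains s r where "0 < s" "s < h" "0 < r" "r < h"
    "f (x + h *\<^sub>R u + h *\<^sub>R v) - f (x + h *\<^sub>R u) - f (x + h *\<^sub>R v) + f x =
      h * h * frechet_derivative (\<lambda>y. frechet_derivative f (at y) u) (at (x + s *\<^sub>R u + r *\<^sub>R v)) v"
proof -
  let ?Du = "\<lambda>y. frechet_derivative f (at y) u"
  \<comment> \<open>The first difference in direction \<open>v\<close>, transported along
    \<open>u\<close>; its increment over \<open>h\<close> is the second difference of
    \<open>f\<close>.\<close>
  define g where "g s = f (x + h *\<^sub>R v + s *\<^sub>R u) - f (x + s *\<^sub>R u)" for s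
  have "\<exists>s. 0 < s \<and> s < h \<and> g h - g 0 =
      (h - 0) * (?Du (x + h *\<^sub>R v + s *\<^sub>R u) - ?Du (x + s *\<^sub>R u))"
  proof (rule MVT2[OF h])
    fix s assume "0 \<le> s" "s \<le> h"
    then have "x + h *\<^sub>R v + s *\<^sub>R u \<in> S" "x + s *\<^sub>R u \<in> S"
      using S[of s h] S[of s 0] h by (simp_all add: algebra_simps)
    then show "(g has_real_derivative ?Du (x + h *\<^sub>R v + s *\<^sub>R u) - ?Du (x + s *\<^sub>R u)) (at s)"
      unfolding g_def by (intro DERIV_diff smooth_on_has_real_derivative_line[OF f])
  qed
  then obtain s where s: "0 < s" "s < h"
    "g h - g 0 = h * (?Du (x + h *\<^sub>R v + s *\<^sub>R u) - ?Du (x + s *\<^sub>R u))" by auto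
  define k where "k r = ?Du (x + s *\<^sub>R u + r *\<^sub>R v)" for r
  have "\<exists>r. 0 < r \<and> r < h \<and> k h - k 0 =
      (h - 0) * frechet_derivative ?Du (at (x + s *\<^sub>R u + r *\<^sub>R v)) v"
  proof (rule MVT2[OF h])
    fix r assume "0 \<le> r" "r \<le> h"
    then show "(k has_real_derivative frechet_derivative ?Du (at (x + s *\<^sub>R u + r *\<^sub>R v)) v) (at r)"
      unfolding k_def using S s
      by (intro smooth_on_has_real_derivative_line[OF smooth_on_frechet_derivative[OF f]]) auto
  qed
  then obtain r where r: "0 < r" "r < h"
    "k h - k 0 = h * frechet_derivative ?Du (at (x + s *\<^sub>R u + r *\<^sub>R v)) v" by auto
  have "f (x + h *\<^sub>R u + h *\<^sub>R v) - f (x + h *\<^sub>R u) - f (x + h *\<^sub>R v) + f x = g h - g 0"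
    by (simp add: g_def algebra_simps)
  also have "\<dots> = h * (k h - k 0)" using s by (simp add: k_def algebra_simps)
  finally show ?thesis using that[OF s(1,2) r(1,2)] r(3) by (simp only: mult.assoc)
qed

text \<open>Schwarz's theorem: the second difference is symmetric in \<open>u\<close> and
  \<open>v\<close>, and it equals \<open>h * h\<close> times either mixed derivative at some point
  of a small parallelogram. Continuity of both mixed derivatives at \<open>x\<close> does the
  rest.\<close>

lemma mixed_frechet_derivative_commute:
  fixes f :: "'a::euclidean_space \<Rightarrow> real"
  assumes f: "smooth_on S f" and S: "open S" "x \<in> S"
  shows "frechet_derivative (\<lambda>y. frechet_derivative f (at y) u) (at x) v =
    frechet_derivative (\<lambda>y. frechet_derivative f (at y) v) (at x) u"
proof -
  let ?P = "\<lambda>y. frechet_derivative (\<lambda>y. frechet_derivative f (at y) u) (at y) v"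
  let ?Q = "\<lambda>y. frechet_derivative (\<lambda>y. frechet_derivative f (at y) v) (at y) u"
  have cont: "isCont ?P x" "isCont ?Q x"
    using smooth_on_continuous_on[OF smooth_on_frechet_derivative[OF smooth_on_frechet_derivative[OF f]]] S
    by (auto simp: continuous_on_eq_continuous_at)
  have "dist (?P x) (?Q x) \<le> e" if "e > 0" for e
  proof -
    obtain d1 where d1: "d1 > 0" "\<And>y. dist y x < d1 \<Longrightarrow> dist (?P y) (?P x) < e / 2"
      using cont(1) \<open>e > 0\<close> unfolding continuous_at_eps_delta by (meson half_gt_zero)
    obtain d2 where d2: "d2 > 0" "\<And>y. dist y x < d2 \<Longrightarrow> dist (?Q y) (?Q x) < e / 2"
      using cont(2) \<open>e > 0\<close> unfolding continuous_at_eps_delta by (meson half_gt_zero)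
    obtain d3 where d3: "d3 > 0" "ball x d3 \<subseteq> S" using S open_contains_ball by blast
    define d where "d = min d1 (min d2 d3)"
    \<comment> \<open>Keeps the parallelogram with sides \<open>h *\<^sub>R u\<close> and
      \<open>h *\<^sub>R v\<close> inside the ball of radius \<open>d\<close>; the summand 1 covers
      the case that \<open>u\<close> and \<open>v\<close> both vanish.\<close>
    define h where "h = d / (norm u + norm v + 1)"
    have N: "norm u + norm v + 1 > 0" by (smt (verit) norm_ge_zero)
    have "d > 0" using d1 d2 d3 by (simp add: d_def)
    then have "h > 0" using N by (simp add: h_def)
    have near: "dist (x + s *\<^sub>R u + r *\<^sub>R v) x < d"
      if "0 \<le> s" "s \<le> h" "0 \<le> r" "r \<le> h" for s r
    proof -
      have "dist (x + s *\<^sub>R u + r *\<^sub>R v) x \<le> s * norm u + r * norm v"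
        using that norm_triangle_ineq[of "s *\<^sub>R u" "r *\<^sub>R v"] by (simp add: dist_norm algebra_simps)
      also have "\<dots> \<le> h * norm u + h * norm v"
        using that by (intro add_mono mult_right_mono) auto
      also have "\<dots> < h * (norm u + norm v + 1)" using \<open>h > 0\<close> by (simp add: algebra_simps)
      also have "\<dots> = d" using N by (simp add: h_def)
      finally show ?thesis .
    qed
    have inS: "x + s *\<^sub>R u + r *\<^sub>R v \<in> S"
      if "0 \<le> s" "s \<le> h" "0 \<le> r" "r \<le> h" for s r
      using near[OF that] d3(2) by (auto simp: d_def dist_commute)
    obtain s r where 1: "0 < s" "s < h" "0 < r" "r < h"
      "f (x + h *\<^sub>R u + h *\<^sub>R v) - f (x + h *\<^sub>R u) - f (x + h *\<^sub>R v) + f x =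
        h * h * ?P (x + s *\<^sub>R u + r *\<^sub>R v)"
      using second_difference_mvt[OF f \<open>h > 0\<close> inS] by blast
    have inS': "x + s *\<^sub>R v + r *\<^sub>R u \<in> S"
      if "0 \<le> s" "s \<le> h" "0 \<le> r" "r \<le> h" for s r
      using inS[of r s] that by (simp add: algebra_simps)
    obtain s' r' where 2: "0 < s'" "s' < h" "0 < r'" "r' < h"
      "f (x + h *\<^sub>R v + h *\<^sub>R u) - f (x + h *\<^sub>R v) - f (x + h *\<^sub>R u) + f x =
        h * h * ?Q (x + s' *\<^sub>R v + r' *\<^sub>R u)"
      using second_difference_mvt[OF f \<open>h > 0\<close> inS'] by blast
    \<comment> \<open>Both sides are the same second difference, evaluated with the two directions
      in either order.\<close>
    have "h * h * ?P (x + s *\<^sub>R u + r *\<^sub>R v) = h * h * ?Q (x + s' *\<^sub>R v + r' *\<^sub>R u)"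
      unfolding 1(5)[symmetric] 2(5)[symmetric] by (simp add: algebra_simps)
    then have eq: "?P (x + s *\<^sub>R u + r *\<^sub>R v) = ?Q (x + r' *\<^sub>R u + s' *\<^sub>R v)"
      using \<open>h > 0\<close> by (simp add: algebra_simps)
    have "dist (?P (x + s *\<^sub>R u + r *\<^sub>R v)) (?P x) < e / 2"
      using near[of s r] 1 by (intro d1) (auto simp: d_def)
    moreover have "dist (?Q (x + r' *\<^sub>R u + s' *\<^sub>R v)) (?Q x) < e / 2"
      using near[of r' s'] 2 by (intro d2) (auto simp: d_def)
    ultimately show ?thesis unfolding eq by (smt (verit) dist_commute dist_triangle field_sum_of_halves)
  qed
  then have "dist (?P x) (?Q x) \<le> 0" by (rule field_le_epsilon) simp
  then show ?thesis by (rule dist_le_zero_iff[THEN iffD1])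
qed

subsection \<open>Integration by parts on the whole space\<close>

text \<open>By translation invariance every difference quotient of \<open>g\<close> integrates to
  zero. Compact support and the Lipschitz bound dominate the quotients, so the limit does too.
  Differentiability almost everywhere accommodates cutoffs with kinks.\<close>

lemma integral_directional_derivative_eq_0:
  fixes g :: "'a::euclidean_space \<Rightarrow> real"
  assumes g: "g \<in> borel_measurable borel" and g': "g' \<in> borel_measurable borel"
    and supp: "\<And>x. norm x > r \<Longrightarrow> g x = 0"
    and lip: "\<And>x h. 0 < h \<Longrightarrow> h \<le> 1 \<Longrightarrow> \<bar>g (x + h *\<^sub>R v) - g x\<bar> \<le> M * h"
    and bnd: "\<And>x. \<bar>g x\<bar> \<le> B"
    and der: "AE x in lborel. ((\<lambda>h. g (x + h *\<^sub>R v)) has_real_derivative g' x) (at 0)"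
  shows "integrable lborel g'" and "(LINT x|lborel. g' x) = 0"
proof -
  define h where "h n = 1 / real (Suc n)" for n
  have h: "0 < h n" "h n \<le> 1" for n by (auto simp: h_def)
  have h0: "h \<longlonglongrightarrow> 0" unfolding h_def by (rule LIMSEQ_inverse_real_of_nat[unfolded inverse_eq_divide])
  define s where "s n x = (g (x + h n *\<^sub>R v) - g x) / h n" for n x
  have "M \<ge> 0"
    using lip[of 1 0] by (smt (verit) mult.right_neutral)
  have [measurable]: "g \<in> borel_measurable borel" by (rule g)
  have s_meas: "s n \<in> borel_measurable lborel" for n
    unfolding s_def by measurable
  have int_g: "integrable lborel g"
  proof (rule Bochner_Integration.integrable_bound)
    show "integrable lborel (\<lambda>x::'a. B * indicator (cball 0 r) x)"
      by (intro integrable_mult_right integrable_real_indicator) (auto simp flip: infinity_ennreal_def intro: emeasure_bounded_finite)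
    show "AE x in lborel. norm (g x) \<le> norm (B * indicator (cball 0 r) x)"
      using bnd supp by (intro AE_I2) (smt (verit) indicator_simps mem_cball_0 mult_cancel_left1
          mult_zero_right norm_zero real_norm_def)
  qed (use g in simp)
  have shift: "integrable lborel (\<lambda>x. g (x + c))" "(LINT x|lborel. g (x + c)) = (LINT x|lborel. g x)" for c
  proof -
    have "integrable (distr lborel borel ((+) c)) g" using int_g by (simp add: lborel_distr_plus)
    then show "integrable lborel (\<lambda>x. g (x + c))"
      by (subst (asm) integrable_distr_eq) (use g in \<open>auto simp: add.commute\<close>)
    have "(LINT x|lborel. g x) = (LINT x|distr lborel borel ((+) c). g x)"
      by (simp add: lborel_distr_plus)
    also have "\<dots> = (LINT x|lborel. g (x + c))"
      using g by (subst integral_distr) (auto simp: add.commute)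
    finally show "(LINT x|lborel. g (x + c)) = (LINT x|lborel. g x)" by simp
  qed
  have int_s: "(LINT x|lborel. s n x) = 0" for n
    unfolding s_def using shift int_g by simp
  have lim: "AE x in lborel. (\<lambda>n. s n x) \<longlonglongrightarrow> g' x"
    using der
  proof eventually_elim
    case (elim x)
    then have "((\<lambda>k. (g (x + (0 + k) *\<^sub>R v) - g (x + 0 *\<^sub>R v)) / k) \<longlongrightarrow> g' x) (at 0)"
      by (simp only: has_field_derivative_def[symmetric] DERIV_def)
    moreover have "filterlim h (at 0) sequentially"
      using h0 by (simp add: filterlim_at h_def)
    ultimately show ?case
      unfolding s_def by (auto dest: filterlim_compose)
  qed
  \<comment> \<open>Steps have length at most \<open>norm v\<close>, so every quotient vanishes
    outside the enlarged ball; inside it \<open>lip\<close> bounds the quotient by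
    \<open>M\<close>.\<close>
  define w where "w = (\<lambda>x::'a. M * indicator (cball 0 (r + norm v)) x :: real)"
  have int_w: "integrable lborel w" unfolding w_def
    by (intro integrable_mult_right integrable_real_indicator) (auto simp flip: infinity_ennreal_def intro: emeasure_bounded_finite)
  have "norm (s n x) \<le> w x" for n x
  proof (cases "norm x \<le> r + norm v")
    case True
    then show ?thesis using lip[OF h, of x n] h(1)[of n]
      by (simp add: s_def w_def abs_divide field_simps)
  next
    case False
    have "norm (h n *\<^sub>R v) \<le> norm v" using h[of n] by (simp add: mult_left_le_one_le)
    then have "norm (x + h n *\<^sub>R v) > r"
      using False norm_diff_ineq[of x "h n *\<^sub>R v"] by linarith
    moreover have "norm x > r" using False norm_ge_zero[of v] by linarith
    ultimately show ?thesis using supp False by (simp add: s_def w_def)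
  qed
  then have bound: "AE x in lborel. norm (s n x) \<le> w x" for n by simp
  have g'': "g' \<in> borel_measurable lborel" using g' by simp
  show "integrable lborel g'"
    by (rule integrable_dominated_convergence[OF g'' s_meas int_w lim bound])
  have "(\<lambda>n. LINT x|lborel. s n x) \<longlonglongrightarrow> (LINT x|lborel. g' x)"
    by (rule integral_dominated_convergence[OF g'' s_meas int_w lim bound])
  then show "(LINT x|lborel. g' x) = 0" by (simp add: int_s LIMSEQ_const_iff)
qed

section \<open>Radial cutoff functions\<close>

definition annulus :: "real \<Rightarrow> 'a::real_normed_vector set" where
  "annulus R = {x. R \<le> norm x \<and> norm x \<le> 2 * R}"

text \<open>Linear in the norm between the radii \<open>R\<close> and \<open>2 * R\<close>, so that
  for \<open>R > 0\<close> its gradient there is \<open>- sgn x / R\<close>; paired with a field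
  this gives, up to sign, the averaged flux in \<open>no_flux_at_infinity\<close>.\<close>

definition cutoff :: "real \<Rightarrow> 'a::real_normed_vector \<Rightarrow> real" where
  "cutoff R x = max 0 (min 1 (2 - norm x / R))"

lemma abs_cutoff_le_1: "\<bar>cutoff R x\<bar> \<le> 1"
  by (auto simp: cutoff_def)

lemma cutoff_lipschitz:
  assumes "R > 0"
  shows "\<bar>cutoff R x - cutoff R y\<bar> \<le> norm (x - y) / R"
proof -
  have "\<bar>cutoff R x - cutoff R y\<bar> \<le> \<bar>norm x / R - norm y / R\<bar>"
    by (auto simp: cutoff_def)
  also have "\<dots> = \<bar>norm x - norm y\<bar> / R" using assms by (simp add: diff_divide_distrib[symmetric])
  also have "\<dots> \<le> norm (x - y) / R" using assms norm_triangle_ineq3[of x y] by (intro divide_right_mono) auto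
  finally show ?thesis .
qed

lemma cutoff_eq_0: "R > 0 \<Longrightarrow> norm x > 2 * R \<Longrightarrow> cutoff R x = 0"
  by (auto simp: cutoff_def field_simps)

text \<open>The excluded spheres carry the kinks. The origin, where the norm is not differentiable,
  lies in the inner region where the cutoff is constant.\<close>

lemma cutoff_has_derivative:
  fixes x :: "'a::real_inner"
  assumes R: "R > 0" and x: "norm x \<noteq> R" "norm x \<noteq> 2 * R"
  shows "(cutoff R has_derivative (\<lambda>v. - (indicator (annulus R) x * (sgn x \<bullet> v) / R))) (at x)"
proof -
  have o: "open {x::'a. norm x < R}" "open {x::'a. R < norm x \<and> norm x < 2 * R}" "open {x::'a. 2 * R < norm x}"
    by (auto intro!: open_Collect_less open_Collect_conj continuous_intros)
  consider "norm x < R" | "R < norm x" "norm x < 2 * R" | "2 * R < norm x" using x by linarith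
  then show ?thesis
  proof cases
    case 1
    then have "(cutoff R has_derivative (\<lambda>v. 0)) (at x)"
      by (intro has_derivative_transform_within_open[OF has_derivative_const[of 1] o(1)])
         (use R in \<open>auto simp: cutoff_def field_simps\<close>)
    with 1 show ?thesis by (simp add: annulus_def)
  next
    case 2
    then have "x \<noteq> 0" using R by auto
    then have "((\<lambda>x. 2 - norm x / R) has_derivative (\<lambda>v. - ((sgn x \<bullet> v) / R))) (at x)"
      using R by (auto intro!: derivative_eq_intros has_derivative_norm simp: inner_commute)
    then have "(cutoff R has_derivative (\<lambda>v. - ((sgn x \<bullet> v) / R))) (at x)"
      by (rule has_derivative_transform_within_open[OF _ o(2)])
         (use R 2 in \<open>auto simp: cutoff_def field_simps\<close>)
    with 2 show ?thesis by (simp add: annulus_def)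
  next
    case 3
    then have "(cutoff R has_derivative (\<lambda>v. 0)) (at x)"
      by (intro has_derivative_transform_within_open[OF has_derivative_const[of 0] o(3)])
         (use R in \<open>auto simp: cutoff_eq_0\<close>)
    with 3 show ?thesis by (simp add: annulus_def)
  qed
qed

lemma cutoff_measurable [measurable]: "cutoff R \<in> borel_measurable (borel :: 'a::euclidean_space measure)"
  unfolding cutoff_def[abs_def] by measurable

lemma annulus_measurable [measurable]: "annulus R \<in> sets (borel :: 'a::euclidean_space measure)"
  unfolding annulus_def by measurable

text \<open>Spheres are Lebesgue null; this disposes of the kinks of the cutoff.\<close>

lemma AE_norm_neq: "AE x::'a::euclidean_space in lborel. norm x \<noteq> r"
proof -
  have "sphere (0::'a) r \<in> null_sets lborel"
    using negligible_sphere[of "0::'a" r] by (auto simp: null_sets_completion_iff negligible_iff_null_sets)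
  from AE_not_in[OF this] show ?thesis by simp
qed

text \<open>Off two null spheres, \<open>g'\<close> is the derivative of
  \<open>cutoff R x * W x\<close> along \<open>v\<close>. That product has compact support and is
  Lipschitz along \<open>v\<close> for steps up to 1, so its derivative integrates to zero.\<close>

lemma integral_cutoff_derivative:
  fixes W :: "'a::euclidean_space \<Rightarrow> real" and v :: 'a
  assumes W: "smooth_on UNIV W" and R: "R > 0"
  defines "g' \<equiv> \<lambda>x. cutoff R x * frechet_derivative W (at x) v - indicator (annulus R) x * (sgn x \<bullet> v) / R * W x"
  shows "integrable lborel g'" "(LINT x|lborel. g' x) = 0"
proof -
  define g where "g x = cutoff R x * W x" for x
  \<comment> \<open>The support has radius at most \<open>2 * R\<close>. One \<open>norm v\<close>
    reaches all points from which a step can meet it, the other contains the step itself.\<close>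
  let ?K = "cball (0::'a) (2 * R + 2 * norm v)"
  have cW: "continuous_on S W" "continuous_on S (\<lambda>x. frechet_derivative W (at x) v)" for S
    using W smooth_on_frechet_derivative smooth_on_continuous_on continuous_on_subset by blast+
  have [measurable]: "W \<in> borel_measurable borel" "(\<lambda>x. frechet_derivative W (at x) v) \<in> borel_measurable borel"
    using cW by (auto intro: borel_measurable_continuous_onI)
  have "bounded (W ` ?K)" "bounded ((\<lambda>x. frechet_derivative W (at x) v) ` ?K)"
    using cW by (auto intro!: compact_imp_bounded compact_continuous_image)
  then obtain B B' where "\<forall>x\<in>?K. \<bar>W x\<bar> \<le> B" "\<forall>x\<in>?K. \<bar>frechet_derivative W (at x) v\<bar> \<le> B'"
    unfolding bounded_iff ball_simps real_norm_def by blast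
  then have B: "\<And>x. x \<in> ?K \<Longrightarrow> \<bar>W x\<bar> \<le> B"
    and B': "\<And>x. x \<in> ?K \<Longrightarrow> \<bar>frechet_derivative W (at x) v\<bar> \<le> B'"
    by blast+
  have "B \<ge> 0" "B' \<ge> 0"
    using R by (auto intro!: order_trans[OF abs_ge_zero B[of 0]] order_trans[OF abs_ge_zero B'[of 0]])
  have m: "g \<in> borel_measurable borel" "g' \<in> borel_measurable borel"
    unfolding g_def[abs_def] g'_def sgn_div_norm by measurable
  have supp: "g x = 0" if "norm x > 2 * R" for x
    using cutoff_eq_0[OF R that] by (simp add: g_def)
  have lip: "\<bar>g (x + h *\<^sub>R v) - g x\<bar> \<le> (norm v / R * B + B') * h" if h: "0 < h" "h \<le> 1" for x h
  proof (cases "norm x \<le> 2 * R + norm v")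
    case False
    have "norm (h *\<^sub>R v) \<le> norm v" using h by (simp add: mult_left_le_one_le)
    then have "norm (x + h *\<^sub>R v) > 2 * R"
      using False norm_diff_ineq[of x "h *\<^sub>R v"] by linarith
    moreover have "norm x > 2 * R" using False norm_ge_zero[of v] by linarith
    ultimately show ?thesis using supp \<open>B \<ge> 0\<close> \<open>B' \<ge> 0\<close> R h by simp
  next
    case True
    have inK: "x + s *\<^sub>R v \<in> ?K" if "0 \<le> s" "s \<le> h" for s
    proof -
      have "norm (s *\<^sub>R v) \<le> norm v" using h that by (simp add: mult_left_le_one_le)
      then show ?thesis using True norm_triangle_ineq[of x "s *\<^sub>R v"] by simp
    qed
    have "\<exists>s. 0 < s \<and> s < h \<and> W (x + h *\<^sub>R v) - W (x + 0 *\<^sub>R v) =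
        (h - 0) * frechet_derivative W (at (x + s *\<^sub>R v)) v"
      by (rule MVT2[OF h(1)]) (rule smooth_on_has_real_derivative_line[OF W UNIV_I])
    then obtain s where s: "0 < s" "s < h" and
      "W (x + h *\<^sub>R v) - W x = h * frechet_derivative W (at (x + s *\<^sub>R v)) v" by auto
    then have 1: "\<bar>W (x + h *\<^sub>R v) - W x\<bar> \<le> h * B'"
      using B'[OF inK, of s] h by (simp add: abs_mult)
    have "\<bar>cutoff R (x + h *\<^sub>R v) - cutoff R x\<bar> \<le> h * norm v / R"
      using cutoff_lipschitz[OF R, of "x + h *\<^sub>R v" x] h by simp
    then have 2: "\<bar>(cutoff R (x + h *\<^sub>R v) - cutoff R x) * W x\<bar> \<le> h * norm v / R * B"
      using B[OF inK, of 0] R h unfolding abs_mult by (intro mult_mono) auto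
    have 3: "\<bar>cutoff R (x + h *\<^sub>R v) * (W (x + h *\<^sub>R v) - W x)\<bar> \<le> 1 * (h * B')"
      unfolding abs_mult using abs_cutoff_le_1 1 by (intro mult_mono) auto
    \<comment> \<open>The first summand is controlled by the Lipschitz constant of the cutoff, the
      second by the mean value theorem for \<open>W\<close>.\<close>
    have "g (x + h *\<^sub>R v) - g x =
        (cutoff R (x + h *\<^sub>R v) - cutoff R x) * W x + cutoff R (x + h *\<^sub>R v) * (W (x + h *\<^sub>R v) - W x)"
      by (simp add: g_def algebra_simps)
    then have "\<bar>g (x + h *\<^sub>R v) - g x\<bar> \<le> h * norm v / R * B + 1 * (h * B')"
      using 2 3 by linarith
    then show ?thesis by (simp add: algebra_simps)
  qed
  have bnd: "\<bar>g x\<bar> \<le> B" for x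
  proof (cases "norm x \<le> 2 * R")
    case True
    then have "x \<in> ?K" by (simp add: add_increasing2)
    then have "\<bar>g x\<bar> \<le> 1 * B"
      unfolding g_def abs_mult using abs_cutoff_le_1 B by (intro mult_mono) auto
    then show ?thesis by simp
  qed (use supp \<open>B \<ge> 0\<close> in auto)
  have der: "AE x in lborel. ((\<lambda>h. g (x + h *\<^sub>R v)) has_real_derivative g' x) (at 0)"
    using AE_norm_neq[of R] AE_norm_neq[of "2 * R"]
  proof eventually_elim
    case (elim x)
    then have "(g has_derivative (\<lambda>u. cutoff R x * frechet_derivative W (at x) u
        + - (indicator (annulus R) x * (sgn x \<bullet> u) / R) * W x)) (at x)"
      unfolding g_def
      by (intro has_derivative_mult cutoff_has_derivative[OF R] smooth_on_has_derivative[OF W]) auto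
    then show ?case
      using has_derivative_line[of g _ x 0 v] by (simp add: g'_def)
  qed
  show "integrable lborel g'"
    by (rule integral_directional_derivative_eq_0(1)[OF m supp lip bnd der])
  show "(LINT x|lborel. g' x) = 0"
    by (rule integral_directional_derivative_eq_0(2)[OF m supp lip bnd der])
qed

section \<open>The divergence theorem and integration by parts\<close>

definition smooth_field :: "(real^'k \<Rightarrow> real^'k) \<Rightarrow> bool" where
  "smooth_field V \<longleftrightarrow> (\<forall>i. smooth_on UNIV (\<lambda>x. V x $ i))"

lemma inner_axis_sum: "(x::real^'k) \<bullet> y = (\<Sum>i\<in>UNIV. (x \<bullet> axis i 1) * y $ i)"
  by (simp add: inner_axis) (simp add: inner_vec_def)

text \<open>Against the cutoff, the integral of the divergence equals the averaged flux through the
  annulus. As \<open>R\<close> grows, dominated convergence handles the left side and the flux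
  hypothesis the right side; limits are unique.\<close>

lemma divergence_theorem_no_flux:
  fixes W :: "real^'k \<Rightarrow> real^'k"
  assumes W: "smooth_field W" and int: "integrable lborel (divergence W)" and flux: "no_flux_at_infinity W"
  shows "(LINT x|lborel. divergence W x) = 0"
proof -
  have comp: "smooth_on UNIV (\<lambda>x. W x $ i)" for i using W by (simp add: smooth_field_def)
  define F where "F R = (LINT x:{x. R \<le> norm x \<and> norm x \<le> 2 * R}|lborel. W x \<bullet> sgn x) / R" for R
  have eq: "(LINT x|lborel. cutoff R x * divergence W x) = F R" if R: "R > 0" for R
  proof -
    let ?g = "\<lambda>i x. cutoff R x * frechet_derivative (\<lambda>y. W y $ i) (at x) (axis i 1)
      - indicator (annulus R) x * (sgn x \<bullet> axis i 1) / R * W x $ i"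
    note g = integral_cutoff_derivative[OF comp R]
    have sum: "(\<Sum>i\<in>UNIV. ?g i x) = cutoff R x * divergence W x - indicator (annulus R) x * (W x \<bullet> sgn x) / R" for x
    proof -
      have "(\<Sum>i\<in>UNIV. indicator (annulus R) x * (sgn x \<bullet> axis i 1) / R * W x $ i)
          = indicator (annulus R) x * (sgn x \<bullet> W x) / R"
        unfolding inner_axis_sum[of "sgn x" "W x"] by (simp add: sum_distrib_left sum_divide_distrib mult_ac)
      then show ?thesis by (simp add: sum_subtractf divergence_def sum_distrib_left inner_commute)
    qed
    have i1: "integrable lborel (\<lambda>x. \<Sum>i\<in>UNIV. ?g i x)"
      by (intro Bochner_Integration.integrable_sum g)
    have "(LINT x|lborel. (\<Sum>i\<in>UNIV. ?g i x)) = (\<Sum>i\<in>UNIV. LINT x|lborel. ?g i x)"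
      by (intro Bochner_Integration.integral_sum g)
    also have "\<dots> = 0" by (intro sum.neutral ballI g)
    finally have i2: "(LINT x|lborel. (\<Sum>i\<in>UNIV. ?g i x)) = 0" .
    have i3: "integrable lborel (\<lambda>x. cutoff R x * divergence W x)"
    proof (rule Bochner_Integration.integrable_bound[OF int])
      show "(\<lambda>x. cutoff R x * divergence W x) \<in> borel_measurable lborel"
        using borel_measurable_integrable[OF int] by measurable
      show "AE x in lborel. norm (cutoff R x * divergence W x) \<le> norm (divergence W x)"
        by (intro AE_I2) (simp add: abs_mult mult_left_le_one_le abs_cutoff_le_1)
    qed
    \<comment> \<open>The flux term is integrable as a difference of two functions already known to
      be integrable.\<close>
    have i4: "integrable lborel (\<lambda>x. indicator (annulus R) x * (W x \<bullet> sgn x) / R)"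
      using Bochner_Integration.integrable_diff[OF i3 i1] unfolding sum by simp
    have "(LINT x|lborel. cutoff R x * divergence W x) = (LINT x|lborel. indicator (annulus R) x * (W x \<bullet> sgn x) / R)"
      using i2 Bochner_Integration.integral_diff[OF i3 i4] unfolding sum by simp
    also have "\<dots> = F R"
      by (simp add: F_def set_lebesgue_integral_def annulus_def)
    finally show ?thesis .
  qed
  have meas: "divergence W \<in> borel_measurable lborel" using int by auto
  have "((\<lambda>R. LINT x|lborel. cutoff R x * divergence W x) \<longlongrightarrow> (LINT x|lborel. divergence W x)) at_top"
  proof (rule integral_dominated_convergence_at_top)
    show "integrable lborel (\<lambda>x. \<bar>divergence W x\<bar>)" using int by simp
    show "AE x in lborel. ((\<lambda>R. cutoff R x * divergence W x) \<longlongrightarrow> divergence W x) at_top"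
    proof (intro AE_I2)
      fix x :: "real^'k"
      have "\<forall>\<^sub>F R in at_top. cutoff R x * divergence W x = divergence W x"
        using eventually_gt_at_top[of "norm x + 1"]
      proof eventually_elim
        case (elim R)
        then have "R > 0" using norm_ge_zero[of x] by linarith
        then show ?case using elim by (auto simp: cutoff_def field_simps)
      qed
      then show "((\<lambda>R. cutoff R x * divergence W x) \<longlongrightarrow> divergence W x) at_top"
        by (rule tendsto_eventually)
    qed
    show "\<forall>\<^sub>F R in at_top. AE x in lborel. norm (cutoff R x * divergence W x) \<le> \<bar>divergence W x\<bar>"
      by (intro always_eventually allI AE_I2) (simp add: abs_mult mult_left_le_one_le abs_cutoff_le_1)
  qed (use meas in measurable)
  then have "(F \<longlongrightarrow> (LINT x|lborel. divergence W x)) at_top"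
    by (rule Lim_transform_eventually) (rule eventually_mono[OF eventually_gt_at_top eq])
  moreover have "(F \<longlongrightarrow> 0) at_top" using flux unfolding no_flux_at_infinity_def F_def .
  ultimately show ?thesis using tendsto_unique[OF trivial_limit_at_top_linorder] by blast
qed

lemma divergence_scaleR:
  assumes f: "smooth_on UNIV f" and V: "smooth_field V"
  shows "divergence (\<lambda>x. f x *\<^sub>R V x) x = f x * divergence V x + grad f x \<bullet> V x"
proof -
  have "frechet_derivative (\<lambda>y. (f y *\<^sub>R V y) $ i) (at x) (axis i 1) =
      f x * frechet_derivative (\<lambda>y. V y $ i) (at x) (axis i 1) + grad f x $ i * V x $ i" for i
  proof -
    have "((\<lambda>y. (f y *\<^sub>R V y) $ i) has_derivative
        (\<lambda>v. f x * frechet_derivative (\<lambda>y. V y $ i) (at x) v + frechet_derivative f (at x) v * V x $ i)) (at x)"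
      using has_derivative_mult[OF smooth_on_has_derivative[OF f UNIV_I]
        smooth_on_has_derivative[OF V[unfolded smooth_field_def, rule_format] UNIV_I]] by simp
    from frechet_derivative_at[OF this, symmetric] show ?thesis by (simp add: grad_def)
  qed
  then show ?thesis by (simp add: divergence_def inner_vec_def sum.distrib sum_distrib_left)
qed

lemma smooth_field_scaleR:
  "smooth_on UNIV f \<Longrightarrow> smooth_field V \<Longrightarrow> smooth_field (\<lambda>x. f x *\<^sub>R V x)"
  by (simp add: smooth_field_def smooth_on_mult)

text \<open>By the product rule, the divergence of \<open>f x *\<^sub>R V x\<close> is the sum of
  the two integrands. Admissibility makes it integrable and free of flux at infinity, so it
  integrates to zero.\<close>

lemma integration_by_parts:
  assumes f: "smooth_on UNIV f" and V: "smooth_field V" and adm: "ibp_admissible f V"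
  shows "(LINT x|lborel. f x * divergence V x) = - (LINT x|lborel. grad f x \<bullet> V x)"
proof -
  have int: "integrable lborel (\<lambda>x. f x * divergence V x)" "integrable lborel (\<lambda>x. grad f x \<bullet> V x)"
    and flux: "no_flux_at_infinity (\<lambda>x. f x *\<^sub>R V x)" using adm by (auto simp: ibp_admissible_def)
  have d: "divergence (\<lambda>x. f x *\<^sub>R V x) = (\<lambda>x. f x * divergence V x + grad f x \<bullet> V x)"
    using divergence_scaleR[OF f V] by auto
  have "(LINT x|lborel. divergence (\<lambda>x. f x *\<^sub>R V x) x) = 0"
    using int by (intro divergence_theorem_no_flux smooth_field_scaleR f V flux) (simp add: d)
  then show ?thesis using int by (simp add: d)
qed

subsection \<open>The differential operators\<close>

lemma grad_eqI: "(f has_derivative D) (at x) \<Longrightarrow> grad f x = (\<chi> i. D (axis i 1))"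
  by (simp add: grad_def frechet_derivative_at[symmetric])

lemma grad_add:
  "smooth_on UNIV f \<Longrightarrow> smooth_on UNIV g \<Longrightarrow> grad (\<lambda>x. f x + g x) x = grad f x + grad g x"
  by (subst grad_eqI[OF has_derivative_add[OF smooth_on_has_derivative smooth_on_has_derivative]])
     (auto simp: grad_def vec_eq_iff)

lemma grad_ln:
  assumes f: "smooth_on UNIV f" and pos: "f x > 0"
  shows "grad (\<lambda>y. ln (f y)) x = grad f x /\<^sub>R f x"
proof -
  have "((\<lambda>y. ln (f y)) has_derivative (\<lambda>v. inverse (f x) * frechet_derivative f (at x) v)) (at x)"
    using pos smooth_on_has_derivative[OF f UNIV_I, of x]
    by (auto intro!: derivative_eq_intros simp: field_simps)
  from grad_eqI[OF this] show ?thesis by (simp add: grad_def vec_eq_iff)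
qed

lemma smooth_field_grad: "smooth_on UNIV f \<Longrightarrow> smooth_field (grad f)"
  by (simp add: smooth_field_def grad_def[abs_def] smooth_on_frechet_derivative)

lemma smooth_on_divergence: "smooth_field V \<Longrightarrow> smooth_on UNIV (divergence V)"
  unfolding smooth_field_def divergence_def[abs_def]
  by (intro smooth_on_sum smooth_on_frechet_derivative) auto

lemma smooth_on_inner: "smooth_field V \<Longrightarrow> smooth_field W \<Longrightarrow> smooth_on UNIV (\<lambda>x. V x \<bullet> W x)"
  unfolding smooth_field_def inner_vec_def inner_real_def
  by (intro smooth_on_sum smooth_on_mult) auto

lemma smooth_on_matrix_component:
  fixes \<sigma> :: "real^'k \<Rightarrow> real^'r^'k"
  assumes "smooth_on UNIV \<sigma>"
  shows "smooth_on UNIV (\<lambda>x. \<sigma> x $ i $ j)"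
  using smooth_on_bounded_linear[OF open_UNIV
      bounded_linear_compose[OF bounded_linear_vec_nth bounded_linear_vec_nth] assms] .

section \<open>Diffusion fluxes, generators and Gamma operators\<close>

definition diffusion_flux :: "(real^'k \<Rightarrow> real^'r^'k) \<Rightarrow> (real^'k \<Rightarrow> real) \<Rightarrow> real^'k \<Rightarrow> real^'k" where
  "diffusion_flux \<sigma> f x = (\<sigma> x ** transpose (\<sigma> x)) *v grad f x"

lemma smooth_field_diffusion_flux:
  assumes "smooth_on UNIV \<sigma>" "smooth_on UNIV f"
  shows "smooth_field (diffusion_flux \<sigma> f)"
  unfolding smooth_field_def diffusion_flux_def matrix_vector_mult_def matrix_matrix_mult_def transpose_def
  using smooth_on_matrix_component[OF assms(1)] smooth_field_grad[OF assms(2)]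
  by (auto simp: smooth_field_def intro!: smooth_on_sum smooth_on_mult)

lemma gen_eq:
  "gen \<sigma> \<pi> f x = divergence (diffusion_flux \<sigma> f) x + grad (\<lambda>y. ln (\<pi> y)) x \<bullet> diffusion_flux \<sigma> f x"
  by (simp add: gen_def diffusion_flux_def[abs_def])

text \<open>Moving one transpose across the inner product gives the gradient-field pairing that
  integration by parts produces.\<close>

lemma Gamma1_eq: "Gamma1 \<sigma> f g x = grad f x \<bullet> diffusion_flux \<sigma> g x"
  by (simp add: Gamma1_def diffusion_flux_def transpose_matrix_vector dot_lmul_matrix
      matrix_vector_mul_assoc[symmetric])

lemma Gamma1_commute: "Gamma1 \<sigma> f g x = Gamma1 \<sigma> g f x"
  by (simp add: Gamma1_def inner_commute)

lemma Gamma1_add_left: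
  "smooth_on UNIV f \<Longrightarrow> smooth_on UNIV g \<Longrightarrow>
    Gamma1 \<sigma> (\<lambda>x. f x + g x) h x = Gamma1 \<sigma> f h x + Gamma1 \<sigma> g h x"
  by (simp add: Gamma1_eq grad_add inner_add_left)

lemma smooth_on_gen:
  assumes "smooth_on UNIV \<sigma>" "smooth_on UNIV \<pi>" "\<And>x. \<pi> x > 0" "smooth_on UNIV f"
  shows "smooth_on UNIV (gen \<sigma> \<pi> f)"
  unfolding gen_eq[abs_def]
  by (intro smooth_on_add smooth_on_divergence smooth_on_inner smooth_field_diffusion_flux
      smooth_field_grad smooth_on_ln assms open_UNIV)

lemma smooth_on_Gamma1:
  assumes "smooth_on UNIV \<sigma>" "smooth_on UNIV f" "smooth_on UNIV g"
  shows "smooth_on UNIV (Gamma1 \<sigma> f g)"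
  unfolding Gamma1_eq[abs_def]
  by (intro smooth_on_inner smooth_field_diffusion_flux smooth_field_grad assms)

text \<open>For \<open>p = \<pi>\<close> and a diffusion flux the bracket is \<open>gen\<close>; for
  \<open>p = \<rho>\<close> it acquires an additional \<open>Gamma1\<close> term.\<close>

lemma divergence_scaleR_pos:
  assumes p: "smooth_on UNIV p" "p x > 0" and V: "smooth_field V"
  shows "divergence (\<lambda>x. p x *\<^sub>R V x) x = p x * (divergence V x + grad (\<lambda>y. ln (p y)) x \<bullet> V x)"
  using p(2) by (simp add: divergence_scaleR[OF p(1) V] grad_ln[OF p] distrib_left)

section \<open>Identities for the density and the first variation\<close>

lemma fisher_density_eq:
  "fisher_density a z \<pi> \<rho> x =
    (Gamma1 a (dD \<pi> \<rho>) (dD \<pi> \<rho>) x + Gamma1 z (dD \<pi> \<rho>) (dD \<pi> \<rho>) x) * \<rho> x"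
  by (simp add: fisher_density_def Gamma1_eq diffusion_flux_def matrix_vector_mult_add_rdistrib inner_add_right)

lemma smooth_on_dD:
  assumes "open S" "smooth_on S \<pi>" "\<And>x. x \<in> S \<Longrightarrow> \<pi> x > 0" "smooth_on S \<rho>" "\<And>x. x \<in> S \<Longrightarrow> \<rho> x > 0"
  shows "smooth_on S (dD \<pi> \<rho>)"
  unfolding dD_def[abs_def] using assms
  by (intro smooth_on_add smooth_on_const smooth_on_ln smooth_on_divide) (auto simp: less_imp_neq[THEN not_sym])

text \<open>The additive constant of \<open>dD\<close> has zero gradient; the rest is the splitting
  of \<open>ln \<rho>\<close> into \<open>ln \<pi>\<close> and the logarithm of the ratio, and the
  logarithmic derivative of the ratio.\<close>

lemma grad_ln_ratio:
  assumes \<pi>: "smooth_on UNIV \<pi>" "\<And>x. \<pi> x > 0" and \<rho>: "smooth_on UNIV \<rho>" "\<And>x. \<rho> x > 0"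
  shows "grad (\<lambda>y. ln (\<rho> y / \<pi> y)) x = grad (dD \<pi> \<rho>) x"
    and "grad (\<lambda>y. ln (\<rho> y)) x = grad (\<lambda>y. ln (\<pi> y)) x + grad (dD \<pi> \<rho>) x"
    and "grad (\<lambda>y. \<rho> y / \<pi> y) x = (\<rho> x / \<pi> x) *\<^sub>R grad (dD \<pi> \<rho>) x"
proof -
  have nz: "\<pi> x \<noteq> 0" "\<rho> x \<noteq> 0" for x using \<pi>(2)[of x] \<rho>(2)[of x] by auto
  have r: "smooth_on UNIV (\<lambda>y. \<rho> y / \<pi> y)" by (intro smooth_on_divide nz \<pi> \<rho> open_UNIV)
  have rpos: "\<rho> x / \<pi> x > 0" for x using \<pi> \<rho> by simp
  have l: "smooth_on UNIV (\<lambda>y. ln (\<rho> y / \<pi> y))" by (intro smooth_on_ln r rpos open_UNIV)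
  show 1: "grad (\<lambda>y. ln (\<rho> y / \<pi> y)) x = grad (dD \<pi> \<rho>) x"
    using grad_add[OF l smooth_on_const[of _ 1], of x] by (simp add: dD_def[abs_def] grad_def vec_eq_iff)
  have "(\<lambda>y. ln (\<rho> y)) = (\<lambda>y. ln (\<pi> y) + ln (\<rho> y / \<pi> y))"
    using \<pi>(2) \<rho>(2) nz by (simp add: ln_div fun_eq_iff)
  then have "grad (\<lambda>y. ln (\<rho> y)) x = grad (\<lambda>y. ln (\<pi> y) + ln (\<rho> y / \<pi> y)) x" by simp
  also have "\<dots> = grad (\<lambda>y. ln (\<pi> y)) x + grad (dD \<pi> \<rho>) x"
    unfolding 1[symmetric] by (intro grad_add smooth_on_ln \<pi> l open_UNIV)
  finally show "grad (\<lambda>y. ln (\<rho> y)) x = grad (\<lambda>y. ln (\<pi> y)) x + grad (dD \<pi> \<rho>) x" .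
  show "grad (\<lambda>y. \<rho> y / \<pi> y) x = (\<rho> x / \<pi> x) *\<^sub>R grad (dD \<pi> \<rho>) x"
    unfolding 1[symmetric] grad_ln[OF r rpos] using nz by simp
qed

text \<open>In the gradient of \<open>ln \<rho>\<close>, the part from \<open>ln \<pi>\<close>
  completes the generator and the part from \<phi> gives \<open>Gamma1\<close>. With
  \<open>a\<close> this rewrites the flow, with \<open>z\<close> the result of integrating the mixed
  term by parts.\<close>

lemma divergence_density_flux:
  assumes \<sigma>: "smooth_on UNIV \<sigma>" and \<pi>: "smooth_on UNIV \<pi>" "\<And>x. \<pi> x > 0"
    and \<rho>: "smooth_on UNIV \<rho>" "\<And>x. \<rho> x > 0"
  defines "\<phi> \<equiv> dD \<pi> \<rho>"
  shows "divergence (\<lambda>x. \<rho> x *\<^sub>R diffusion_flux \<sigma> \<phi> x) x = \<rho> x * (gen \<sigma> \<pi> \<phi> x + Gamma1 \<sigma> \<phi> \<phi> x)"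
proof -
  have "smooth_on UNIV \<phi>" unfolding \<phi>_def by (intro smooth_on_dD \<pi> \<rho> open_UNIV)
  then show ?thesis
    by (simp add: divergence_scaleR_pos[OF \<rho> smooth_field_diffusion_flux[OF \<sigma>]] grad_ln_ratio(2)[OF \<pi> \<rho>]
        gen_eq Gamma1_eq inner_add_left \<phi>_def)
qed

text \<open>Multiplied by \<pi>, the generator is a pure divergence. Splitting \<rho> as \<pi> times
  \<rho>/\<pi> and integrating by parts puts the gradient on the ratio, and that gradient is the
  ratio times the gradient of \<open>dD\<close>.\<close>

lemma integral_gen_density:
  assumes a: "smooth_on UNIV a" and \<pi>: "smooth_on UNIV \<pi>" "\<And>x. \<pi> x > 0"
    and \<rho>: "smooth_on UNIV \<rho>" "\<And>x. \<rho> x > 0" and f: "smooth_on UNIV f"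
    and adm: "ibp_admissible (\<lambda>x. \<rho> x / \<pi> x) (\<lambda>x. \<pi> x *\<^sub>R diffusion_flux a f x)"
  shows "has_bochner_integral lborel (\<lambda>x. gen a \<pi> f x * \<rho> x)
    (- (LINT x|lborel. Gamma1 a f (dD \<pi> \<rho>) x * \<rho> x))"
proof -
  have nz: "\<pi> x \<noteq> 0" for x using \<pi>(2)[of x] by simp
  have V: "smooth_field (diffusion_flux a f)" by (intro smooth_field_diffusion_flux a f)
  have 1: "\<rho> x / \<pi> x * divergence (\<lambda>x. \<pi> x *\<^sub>R diffusion_flux a f x) x = gen a \<pi> f x * \<rho> x" for x
    using nz[of x] by (simp add: divergence_scaleR_pos[OF \<pi> V] gen_eq)
  have 2: "grad (\<lambda>x. \<rho> x / \<pi> x) x \<bullet> (\<pi> x *\<^sub>R diffusion_flux a f x) = Gamma1 a f (dD \<pi> \<rho>) x * \<rho> x" for x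
    unfolding Gamma1_commute[of a f] using nz[of x]
    by (simp add: grad_ln_ratio(3)[OF \<pi> \<rho>] Gamma1_eq)
  have "smooth_on UNIV (\<lambda>x. \<rho> x / \<pi> x)" by (intro smooth_on_divide nz \<pi> \<rho> open_UNIV)
  from integration_by_parts[OF this smooth_field_scaleR[OF \<pi>(1) V] adm] adm show ?thesis
    unfolding has_bochner_integral_iff ibp_admissible_def 1 2 by simp
qed

lemma integral_times_divergence_flux:
  assumes \<sigma>: "smooth_on UNIV \<sigma>" and \<rho>: "smooth_on UNIV \<rho>" and \<phi>: "smooth_on UNIV \<phi>" and f: "smooth_on UNIV f"
    and adm: "ibp_admissible f (\<lambda>x. \<rho> x *\<^sub>R diffusion_flux \<sigma> \<phi> x)"
  obtains I where
    "has_bochner_integral lborel (\<lambda>x. f x * divergence (\<lambda>x. \<rho> x *\<^sub>R diffusion_flux \<sigma> \<phi> x) x) (- I)"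
    "has_bochner_integral lborel (\<lambda>x. Gamma1 \<sigma> f \<phi> x * \<rho> x) I"
proof
  have *: "grad f x \<bullet> (\<rho> x *\<^sub>R diffusion_flux \<sigma> \<phi> x) = Gamma1 \<sigma> f \<phi> x * \<rho> x" for x
    by (simp add: Gamma1_eq)
  note ibp = integration_by_parts[OF f smooth_field_scaleR[OF \<rho> smooth_field_diffusion_flux[OF \<sigma> \<phi>]] adm]
  show "has_bochner_integral lborel (\<lambda>x. f x * divergence (\<lambda>x. \<rho> x *\<^sub>R diffusion_flux \<sigma> \<phi> x) x)
      (- (LINT x|lborel. Gamma1 \<sigma> f \<phi> x * \<rho> x))"
    using adm ibp unfolding has_bochner_integral_iff ibp_admissible_def * by simp
  show "has_bochner_integral lborel (\<lambda>x. Gamma1 \<sigma> f \<phi> x * \<rho> x) (LINT x|lborel. Gamma1 \<sigma> f \<phi> x * \<rho> x)"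
    using adm unfolding has_bochner_integral_iff ibp_admissible_def * by simp
qed

subsection \<open>Dissipation of the Fisher information\<close>

text \<open>Time and space derivatives are directional derivatives of one jointly smooth function,
  along \<open>(1, 0)\<close> and \<open>(0, axis i 1)\<close>, so they commute by the symmetry of
  mixed derivatives.\<close>

lemma has_vector_derivative_grad:
  fixes \<Phi> :: "real \<times> (real^'k) \<Rightarrow> real"
  assumes J: "open J" "t \<in> J" and \<Phi>: "smooth_on (J \<times> UNIV) \<Phi>"
  defines "h \<equiv> \<lambda>x. deriv (\<lambda>s. \<Phi> (s, x)) t"
  shows "((\<lambda>s. \<Phi> (s, x)) has_real_derivative h x) (at t)"
    and "smooth_on UNIV h"
    and "((\<lambda>s. grad (\<lambda>y. \<Phi> (s, y)) x) has_vector_derivative grad h x) (at t)"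
proof -
  let ?S = "J \<times> (UNIV :: (real^'k) set)"
  have S: "open ?S" "(t, x) \<in> ?S" for x using J by (auto intro: open_Times)
  let ?Dt = "\<lambda>p. frechet_derivative \<Phi> (at p) (1, 0)"
  have line: "((\<lambda>s. f (s, x)) has_real_derivative frechet_derivative f (at (t, x)) (1, 0)) (at t)"
    if "smooth_on ?S f" for f :: "real \<times> (real^'k) \<Rightarrow> real" and x
    using smooth_on_has_real_derivative_line[OF that, of "(0, x)" t "(1, 0)"] J by simp
  have slice: "frechet_derivative (\<lambda>y. f (s, y)) (at x) v = frechet_derivative f (at (s, x)) (0, v)"
    if "smooth_on ?S f" "s \<in> J" for f :: "real \<times> (real^'k) \<Rightarrow> real" and s x v
  proof -
    have "((\<lambda>y. (s, y)) has_derivative (\<lambda>v. (0, v))) (at x)"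
      by (auto intro!: derivative_eq_intros)
    from has_derivative_compose[OF this smooth_on_has_derivative[OF that(1)]] that(2)
    have "((\<lambda>y. f (s, y)) has_derivative (\<lambda>v. frechet_derivative f (at (s, x)) (0, v))) (at x)" by simp
    from frechet_derivative_at[OF this] show ?thesis by metis
  qed
  have h: "h = (\<lambda>x. ?Dt (t, x))"
    unfolding h_def by (intro ext DERIV_imp_deriv line \<Phi>)
  show "((\<lambda>s. \<Phi> (s, x)) has_real_derivative h x) (at t)" unfolding h by (rule line[OF \<Phi>])
  show "smooth_on UNIV h" unfolding h
    by (rule smooth_on_slice[OF open_UNIV smooth_on_frechet_derivative[OF \<Phi>] J(2)])
  have comp: "((\<lambda>s. grad (\<lambda>y. \<Phi> (s, y)) x $ i) has_real_derivative grad h x $ i) (at t)" for i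
  proof -
    let ?Di = "\<lambda>p. frechet_derivative \<Phi> (at p) (0, axis i 1)"
    have "frechet_derivative ?Di (at (t, x)) (1, 0) = frechet_derivative ?Dt (at (t, x)) (0, axis i 1)"
      by (rule mixed_frechet_derivative_commute[OF \<Phi> S])
    also have "\<dots> = grad h x $ i"
      using slice[OF smooth_on_frechet_derivative[OF \<Phi>] J(2)] by (simp add: grad_def h)
    finally have "((\<lambda>s. ?Di (s, x)) has_real_derivative grad h x $ i) (at t)"
      using line[OF smooth_on_frechet_derivative[OF \<Phi>], of x "(0, axis i 1)"] by simp
    \<comment> \<open>The slice formula is available only for times in \<open>J\<close>; openness of
      \<open>J\<close> makes this enough at \<open>t\<close>.\<close>
    then show ?thesis
      by (rule has_field_derivative_transform_within_open[OF _ J])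
         (simp add: grad_def slice[OF \<Phi>])
  qed
  show "((\<lambda>s. grad (\<lambda>y. \<Phi> (s, y)) x) has_vector_derivative grad h x) (at t)"
    unfolding has_vector_derivative_def
  proof (subst has_derivative_componentwise_within, intro ballI)
    fix b :: "real^'k" assume "b \<in> Basis"
    then obtain i where b: "b = axis i 1" by (auto simp: Basis_vec_def)
    show "((\<lambda>s. grad (\<lambda>y. \<Phi> (s, y)) x \<bullet> b) has_derivative (\<lambda>r. (r *\<^sub>R grad h x) \<bullet> b)) (at t)"
      using comp[of i] by (simp add: b inner_axis has_field_derivative_def mult_commute_abs)
  qed
qed

text \<open>Only the gradients depend on time, and by symmetry the two terms of the product rule
  coincide; hence the factor 2.\<close>

lemma has_real_derivative_Gamma1:
  assumes "\<And>x. ((\<lambda>s. grad (\<phi> s) x) has_vector_derivative grad h x) (at t)"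
  shows "((\<lambda>s. Gamma1 \<sigma> (\<phi> s) (\<phi> s) x) has_real_derivative 2 * Gamma1 \<sigma> h (\<phi> t) x) (at t)"
proof -
  have "((\<lambda>s. transpose (\<sigma> x) *v grad (\<phi> s) x) has_vector_derivative transpose (\<sigma> x) *v grad h x) (at t)"
    by (rule bounded_linear.has_vector_derivative[OF matrix_vector_mul_bounded_linear assms])
  from bounded_bilinear.has_vector_derivative[OF bounded_bilinear_inner this this]
  show ?thesis
    by (simp add: Gamma1_def has_real_derivative_iff_has_vector_derivative inner_commute)
qed

text \<open>The mean value inequality turns the bound on \<open>F'\<close> into the same bound on
  the difference quotients; dominated convergence along arbitrary null sequences then gives the
  derivative.\<close>

lemma has_real_derivative_lebesgue_integral:
  fixes F F' :: "real \<Rightarrow> 'a \<Rightarrow> real"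
  assumes J: "open J" "t \<in> J"
    and int: "\<And>s. s \<in> J \<Longrightarrow> integrable M (F s)"
    and der: "\<And>s x. s \<in> J \<Longrightarrow> ((\<lambda>s. F s x) has_real_derivative F' s x) (at s)"
    and dom: "\<epsilon> > 0" "integrable M g" "\<And>s x. s \<in> J \<Longrightarrow> \<bar>s - t\<bar> < \<epsilon> \<Longrightarrow> \<bar>F' s x\<bar> \<le> g x"
  shows "((\<lambda>s. integral\<^sup>L M (F s)) has_real_derivative integral\<^sup>L M (F' t)) (at t)"
proof -
  obtain e where e: "e > 0" "ball t e \<subseteq> J" using J open_contains_ball by blast
  define d where "d = min e \<epsilon>"
  have d: "d > 0" using e dom by (simp add: d_def)
  have near: "s \<in> J" "\<bar>s - t\<bar> < \<epsilon>" if "\<bar>s - t\<bar> < d" for s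
    using that e by (auto simp: d_def dist_real_def abs_minus_commute subset_iff)
  have quotient: "\<bar>(F (t + h) x - F t x) / h\<bar> \<le> g x" if h: "h \<noteq> 0" "\<bar>h\<bar> < d" for h x
  proof -
    have "norm (F (t + h) x - F t x) \<le> g x * norm (t + h - t)"
    proof (rule field_differentiable_bound[where S = "{t - \<bar>h\<bar>..t + \<bar>h\<bar>}" and f' = "\<lambda>s. F' s x"])
      fix s assume s: "s \<in> {t - \<bar>h\<bar>..t + \<bar>h\<bar>}"
      then have "\<bar>s - t\<bar> < d" using h by auto
      from near[OF this] show "norm (F' s x) \<le> g x"
        "((\<lambda>s. F s x) has_field_derivative F' s x) (at s within {t - \<bar>h\<bar>..t + \<bar>h\<bar>})"
        using dom(3) der by (auto intro: has_field_derivative_at_within)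
    qed auto
    then show ?thesis using h by (simp add: abs_divide field_simps)
  qed
  have "((\<lambda>h. (integral\<^sup>L M (F (t + h)) - integral\<^sup>L M (F t)) / h) \<longlongrightarrow> integral\<^sup>L M (F' t)) (at 0)"
    unfolding tendsto_at_iff_sequentially comp_def
  proof (intro allI impI)
    fix X :: "nat \<Rightarrow> real"
    assume X0: "\<forall>i. X i \<in> UNIV - {0}" and X: "X \<longlonglongrightarrow> 0"
    obtain N where N: "\<And>n. n \<ge> N \<Longrightarrow> \<bar>X n\<bar> < d"
      using LIMSEQ_D[OF X d] by auto
    \<comment> \<open>Dropping the first \<open>N\<close> terms makes the domination hold for every
      index.\<close>
    define Y where "Y n = X (n + N)" for n
    have Y: "Y n \<noteq> 0" "\<bar>Y n\<bar> < d" for n using X0 N by (auto simp: Y_def)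
    have Y0: "Y \<longlonglongrightarrow> 0" unfolding Y_def using X by (rule LIMSEQ_ignore_initial_segment)
    define q where "q n x = (F (t + Y n) x - F t x) / Y n" for n x
    have intY: "integrable M (F (t + Y n))" "integrable M (F t)" for n
      using near(1)[of "t + Y n"] Y(2)[of n] int J by auto
    have q: "q n \<in> borel_measurable M" for n
      unfolding q_def using borel_measurable_integrable[OF intY(1)] borel_measurable_integrable[OF intY(2)]
      by measurable
    have lim: "(\<lambda>n. q n x) \<longlonglongrightarrow> F' t x" for x
    proof -
      have "((\<lambda>h. (F (t + h) x - F t x) / h) \<longlongrightarrow> F' t x) (at 0)"
        using der[OF J(2), of x] by (simp add: DERIV_def)
      moreover have "filterlim Y (at 0) sequentially"
        using Y0 Y(1) by (simp add: filterlim_at)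
      ultimately show ?thesis unfolding q_def by (rule filterlim_compose)
    qed
    have "(\<lambda>n. integral\<^sup>L M (q n)) \<longlonglongrightarrow> integral\<^sup>L M (F' t)"
    proof (rule integral_dominated_convergence[where w = g])
      \<comment> \<open>Measurability of \<open>F' t\<close> comes from its being a pointwise limit
        of measurable quotients.\<close>
      show "F' t \<in> borel_measurable M" by (rule borel_measurable_LIMSEQ_real[OF lim q])
      show "AE x in M. norm (q n x) \<le> g x" for n using quotient[OF Y] by (simp add: q_def)
    qed (use q lim dom(2) in auto)
    moreover have "integral\<^sup>L M (q n) = (integral\<^sup>L M (F (t + Y n)) - integral\<^sup>L M (F t)) / Y n" for n
      unfolding q_def using intY by simp
    ultimately show "(\<lambda>n. (integral\<^sup>L M (F (t + X n)) - integral\<^sup>L M (F t)) / X n) \<longlonglongrightarrow> integral\<^sup>L M (F' t)"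
      by (subst LIMSEQ_offset[where k = N]) (simp_all add: Y_def)
  qed
  then show ?thesis by (simp add: DERIV_def)
qed

theorem proposition4p7:
  fixes a :: "real^('n::finite + 'm::finite) \<Rightarrow> real^'n^('n + 'm)"
    and z :: "real^('n + 'm) \<Rightarrow> real^'m^('n + 'm)"
    and \<pi> :: "real^('n + 'm) \<Rightarrow> real"
    and J :: "real set"
    and \<rho> :: "real \<Rightarrow> real^('n + 'm) \<Rightarrow> real"
  assumes "smooth_on UNIV a"
    and "smooth_on UNIV z"
    and "strong_hormander a"
    and "smooth_on UNIV \<pi>"
    and "\<And>x. \<pi> x > 0"
    and "has_bochner_integral lborel \<pi> 1"
    and "open J"
    and "smooth_on (J \<times> UNIV) (\<lambda>(t, x). \<rho> t x)"
    and "\<And>t x. t \<in> J \<Longrightarrow> \<rho> t x > 0"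
    and "\<And>t. t \<in> J \<Longrightarrow> has_bochner_integral lborel (\<rho> t) 1"
    \<comment> \<open>the gradient flow equation\<close>
    and "\<And>t x. t \<in> J \<Longrightarrow>
      ((\<lambda>s. \<rho> s x) has_real_derivative
        divergence (\<lambda>y. \<rho> t y *\<^sub>R ((a y ** transpose (a y)) *v grad (\<lambda>w. ln (\<rho> t w / \<pi> w)) y)) x)
        (at t)"
    \<comment> \<open>the Fisher information is finite and may be differentiated under the integral sign\<close>
    and "\<And>t. t \<in> J \<Longrightarrow> integrable lborel (fisher_density a z \<pi> (\<rho> t))"
    and "\<And>t. t \<in> J \<Longrightarrow> \<exists>\<epsilon>>0. \<exists>g. integrable lborel g \<and>
      (\<forall>s\<in>J. \<bar>s - t\<bar> < \<epsilon> \<longrightarrow> (\<forall>x. \<bar>deriv (\<lambda>r. fisher_density a z \<pi> (\<rho> r) x) s\<bar> \<le> g x))"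
    \<comment> \<open>the integrations by parts make sense without boundary terms\<close>
    and "\<And>t f. t \<in> J \<Longrightarrow>
      f \<in> {gen a \<pi> (dD \<pi> (\<rho> t)), gen z \<pi> (dD \<pi> (\<rho> t)),
           Gamma1 a (dD \<pi> (\<rho> t)) (dD \<pi> (\<rho> t)), Gamma1 z (dD \<pi> (\<rho> t)) (dD \<pi> (\<rho> t))} \<Longrightarrow>
      ibp_admissible f (\<lambda>x. \<rho> t x *\<^sub>R ((a x ** transpose (a x)) *v grad (dD \<pi> (\<rho> t)) x))"
    and "\<And>t. t \<in> J \<Longrightarrow>
      ibp_admissible (\<lambda>x. deriv (\<lambda>s. dD \<pi> (\<rho> s) x) t)
        (\<lambda>x. \<rho> t x *\<^sub>R ((z x ** transpose (z x)) *v grad (dD \<pi> (\<rho> t)) x))"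
    and "\<And>t f. t \<in> J \<Longrightarrow>
      f \<in> {Gamma1 a (dD \<pi> (\<rho> t)) (dD \<pi> (\<rho> t)), Gamma1 z (dD \<pi> (\<rho> t)) (dD \<pi> (\<rho> t))} \<Longrightarrow>
      ibp_admissible (\<lambda>x. \<rho> t x / \<pi> x) (\<lambda>x. \<pi> x *\<^sub>R ((a x ** transpose (a x)) *v grad f x))"
    and "t \<in> J"
  shows "((\<lambda>s. fisher_info a z \<pi> (\<rho> s)) has_real_derivative
      - 2 * (LINT x|lborel.
          (Gamma2 a \<pi> (dD \<pi> (\<rho> t)) x + Gamma2z a z \<pi> (dD \<pi> (\<rho> t)) x) * \<rho> t x)) (at t)"
proof -
  note a = assms(1) and z = assms(2) and \<pi> = assms(4,5) and J = assms(7) and tJ = assms(17)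
  have \<rho>: "smooth_on UNIV (\<rho> s)" "\<rho> s x > 0" if "s \<in> J" for s x
    using smooth_on_slice[OF open_UNIV assms(8) that] assms(9)[OF that] by simp_all
  define \<phi> where "\<phi> s = dD \<pi> (\<rho> s)" for s
  define h where "h s x = deriv (\<lambda>r. \<phi> r x) s" for s x
  define K where "K s = divergence (\<lambda>x. \<rho> s x *\<^sub>R diffusion_flux a (\<phi> s) x)" for s
  define \<Gamma>a where "\<Gamma>a s = Gamma1 a (\<phi> s) (\<phi> s)" for s
  define \<Gamma>z where "\<Gamma>z s = Gamma1 z (\<phi> s) (\<phi> s)" for s
  have \<phi>: "smooth_on UNIV (\<phi> s)" if "s \<in> J" for s
    unfolding \<phi>_def by (intro smooth_on_dD \<pi> \<rho> that open_UNIV)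

  have S: "open (J \<times> (UNIV :: (real^('n + 'm)) set))" using J by (auto intro: open_Times)
  have "smooth_on (J \<times> UNIV) (dD (\<lambda>p. \<pi> (snd p)) (\<lambda>(s, x). \<rho> s x))"
    by (rule smooth_on_dD[OF S smooth_on_snd[OF J open_UNIV \<pi>(1)] _ assms(8)]) (use \<pi> \<rho> in auto)
  moreover have "dD (\<lambda>p. \<pi> (snd p)) (\<lambda>(s, x). \<rho> s x) = (\<lambda>(s, x). \<phi> s x)"
    by (auto simp: dD_def \<phi>_def fun_eq_iff)
  ultimately have \<Phi>: "smooth_on (J \<times> UNIV) (\<lambda>(s, x). \<phi> s x)" by simp
  have h: "((\<lambda>r. \<phi> r x) has_real_derivative h s x) (at s)"
    "smooth_on UNIV (h s)" "((\<lambda>r. grad (\<phi> r) x) has_vector_derivative grad (h s) x) (at s)"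
    if "s \<in> J" for s x
    using has_vector_derivative_grad[OF J that \<Phi>] by (simp_all add: h_def[abs_def])

  \<comment> \<open>The constant in \<open>dD\<close> drops out under the gradient, so
    \<open>K\<close> is the right-hand side of the flow equation.\<close>
  have \<rho>_deriv: "((\<lambda>r. \<rho> r x) has_real_derivative K s x) (at s)" if "s \<in> J" for s x
    using assms(11)[OF that, of x]
    by (simp add: K_def \<phi>_def diffusion_flux_def[abs_def] grad_ln_ratio(1)[OF \<pi> \<rho>[OF that]])
  have h_\<rho>: "h s x * \<rho> s x = K s x" if "s \<in> J" for s x
  proof -
    have "((\<lambda>r. \<phi> r x) has_real_derivative K s x / \<rho> s x) (at s)"
      unfolding \<phi>_def dD_def using \<rho>_deriv[OF that, of x] \<rho>(2)[OF that, of x] \<pi>(2)[of x]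
      by (auto intro!: derivative_eq_intros simp: field_simps)
    then have "h s x = K s x / \<rho> s x" using DERIV_unique h(1)[OF that] by blast
    then show ?thesis using \<rho>(2)[OF that, of x] by simp
  qed
  have h_eq: "h t = (\<lambda>x. gen a \<pi> (\<phi> t) x + \<Gamma>a t x)"
  proof
    fix x
    have "h t x * \<rho> t x = \<rho> t x * (gen a \<pi> (\<phi> t) x + \<Gamma>a t x)"
      unfolding h_\<rho>[OF tJ] unfolding K_def \<phi>_def \<Gamma>a_def \<Gamma>z_def
      by (rule divergence_density_flux[OF a \<pi> \<rho>[OF tJ]])
    then show "h t x = gen a \<pi> (\<phi> t) x + \<Gamma>a t x" using \<rho>(2)[OF tJ, of x] by simp
  qed

  \<comment> \<open>The first two terms come from the motion of the gradients, the last bracket from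
    the motion of the density.\<close>
  define F' where "F' s x = 2 * (Gamma1 a (h s) (\<phi> s) x * \<rho> s x) + 2 * (Gamma1 z (h s) (\<phi> s) x * \<rho> s x)
    + (\<Gamma>a s x * K s x + \<Gamma>z s x * K s x)" for s x
  have F': "((\<lambda>r. fisher_density a z \<pi> (\<rho> r) x) has_real_derivative F' s x) (at s)" if "s \<in> J" for s x
    unfolding fisher_density_eq F'_def \<Gamma>a_def \<Gamma>z_def \<phi>_def[symmetric]
    by (rule DERIV_cong[OF DERIV_mult[OF DERIV_add[OF has_real_derivative_Gamma1[OF h(3)[OF that]]
      has_real_derivative_Gamma1[OF h(3)[OF that]]] \<rho>_deriv[OF that]]]) (simp add: algebra_simps)
  obtain \<epsilon> g where "\<epsilon> > 0" "integrable lborel g"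
    and "\<forall>s\<in>J. \<bar>s - t\<bar> < \<epsilon> \<longrightarrow> (\<forall>x. \<bar>deriv (\<lambda>r. fisher_density a z \<pi> (\<rho> r) x) s\<bar> \<le> g x)"
    using assms(13)[OF tJ] by blast
  then have "((\<lambda>s. fisher_info a z \<pi> (\<rho> s)) has_real_derivative (LINT x|lborel. F' t x)) (at t)"
    unfolding fisher_info_def
    using F' assms(12)
    by (intro has_real_derivative_lebesgue_integral[OF J tJ]) (auto simp: DERIV_imp_deriv[OF F'])
  moreover have "(LINT x|lborel. F' t x) = - 2 * (LINT x|lborel.
      (Gamma2 a \<pi> (\<phi> t) x + Gamma2z a z \<pi> (\<phi> t) x) * \<rho> t x)"
  proof -
    note \<phi>t = \<phi>[OF tJ] and \<rho>t = \<rho>[OF tJ]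
    have La: "smooth_on UNIV (gen a \<pi> (\<phi> t))" and Lz: "smooth_on UNIV (gen z \<pi> (\<phi> t))"
      and Ga: "smooth_on UNIV (\<Gamma>a t)" and Gz: "smooth_on UNIV (\<Gamma>z t)"
      unfolding \<Gamma>a_def \<Gamma>z_def by (intro smooth_on_gen smooth_on_Gamma1 a z \<pi> \<phi>t)+
    have adm: "ibp_admissible f (\<lambda>x. \<rho> t x *\<^sub>R diffusion_flux a (\<phi> t) x)"
      if "f \<in> {gen a \<pi> (\<phi> t), gen z \<pi> (\<phi> t), \<Gamma>a t, \<Gamma>z t}" for f
      using assms(14)[OF tJ, of f] that by (simp add: diffusion_flux_def \<phi>_def \<Gamma>a_def \<Gamma>z_def)
    have admh: "ibp_admissible (h t) (\<lambda>x. \<rho> t x *\<^sub>R diffusion_flux z (\<phi> t) x)"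
      using assms(15)[OF tJ] by (simp add: diffusion_flux_def \<phi>_def h_def[abs_def])
    have admG: "ibp_admissible (\<lambda>x. \<rho> t x / \<pi> x) (\<lambda>x. \<pi> x *\<^sub>R diffusion_flux a f x)"
      if "f \<in> {\<Gamma>a t, \<Gamma>z t}" for f
      using assms(16)[OF tJ, of f] that by (simp add: diffusion_flux_def \<phi>_def \<Gamma>a_def \<Gamma>z_def)
    note ibp = integral_times_divergence_flux[OF a \<rho>t(1) \<phi>t _ adm, folded K_def]
    \<comment> \<open>The numbers \<open>I1\<close> to \<open>I5\<close> name the integrals of the
      \<open>Gamma1\<close> terms, so that the claim reduces to a linear identity among
      them.\<close>
    obtain I1 where I1: "has_bochner_integral lborel (\<lambda>x. Gamma1 a (gen a \<pi> (\<phi> t)) (\<phi> t) x * \<rho> t x) I1"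
      using ibp[OF La] by blast
    obtain I2 where I2: "has_bochner_integral lborel (\<lambda>x. gen z \<pi> (\<phi> t) x * K t x) (- I2)"
      "has_bochner_integral lborel (\<lambda>x. Gamma1 a (gen z \<pi> (\<phi> t)) (\<phi> t) x * \<rho> t x) I2"
      using ibp[OF Lz] by blast
    obtain I3 where I3: "has_bochner_integral lborel (\<lambda>x. \<Gamma>a t x * K t x) (- I3)"
      "has_bochner_integral lborel (\<lambda>x. Gamma1 a (\<Gamma>a t) (\<phi> t) x * \<rho> t x) I3"
      using ibp[OF Ga] by blast
    obtain I4 where I4: "has_bochner_integral lborel (\<lambda>x. \<Gamma>z t x * K t x) (- I4)"
      "has_bochner_integral lborel (\<lambda>x. Gamma1 a (\<Gamma>z t) (\<phi> t) x * \<rho> t x) I4"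
      using ibp[OF Gz] by blast
    obtain I5 where I5: "has_bochner_integral lborel
        (\<lambda>x. h t x * divergence (\<lambda>x. \<rho> t x *\<^sub>R diffusion_flux z (\<phi> t) x) x) (- I5)"
      "has_bochner_integral lborel (\<lambda>x. Gamma1 z (h t) (\<phi> t) x * \<rho> t x) I5"
      using integral_times_divergence_flux[OF z \<rho>t(1) \<phi>t h(2)[OF tJ] admh] by blast
    \<comment> \<open>The exchange of roles: the factor \<rho> of the \<open>z\<close>-divergence
      combines with \<open>h\<close> into \<open>K\<close>, an \<open>a\<close>-divergence, which
      can be integrated by parts against the \<open>z\<close>-quantities.\<close>
    have "h t x * divergence (\<lambda>x. \<rho> t x *\<^sub>R diffusion_flux z (\<phi> t) x) x =
        gen z \<pi> (\<phi> t) x * K t x + \<Gamma>z t x * K t x" for x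
      using divergence_density_flux[OF z \<pi> \<rho>t, of x, folded \<phi>_def]
      by (simp add: h_\<rho>[OF tJ, symmetric] \<Gamma>z_def algebra_simps)
    with I5(1) has_bochner_integral_add[OF I2(1) I4(1)] have I5_eq: "I5 = I2 + I4"
      using has_bochner_integral_eq by fastforce
    have "Gamma1 a (h t) (\<phi> t) x * \<rho> t x =
        Gamma1 a (gen a \<pi> (\<phi> t)) (\<phi> t) x * \<rho> t x + Gamma1 a (\<Gamma>a t) (\<phi> t) x * \<rho> t x" for x
      unfolding h_eq Gamma1_add_left[OF La Ga] by (simp add: distrib_right)
    then have Ih: "has_bochner_integral lborel (\<lambda>x. Gamma1 a (h t) (\<phi> t) x * \<rho> t x) (I1 + I3)"
      using has_bochner_integral_add[OF I1 I3(2)] by simp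
    have "has_bochner_integral lborel (F' t) (2 * (I1 + I3) + 2 * I5 + (- I3 + - I4))"
      unfolding F'_def
      by (intro has_bochner_integral_add has_bochner_integral_mult_right Ih I5(2) I3(1) I4(1))
    \<comment> \<open>Half of the doubled \<open>I3\<close> and \<open>I4\<close> cancels against
      the contribution of the moving density.\<close>
    then have lhs: "(LINT x|lborel. F' t x) = 2 * I1 + 2 * I2 + I3 + I4"
      by (simp add: has_bochner_integral_iff I5_eq)

    have "(LINT x|lborel. Gamma1 a (\<Gamma>a t) (\<phi> t) x * \<rho> t x) = I3"
      "(LINT x|lborel. Gamma1 a (\<Gamma>z t) (\<phi> t) x * \<rho> t x) = I4"
      using I3(2) I4(2) by (simp_all add: has_bochner_integral_iff)
    then have LG: "has_bochner_integral lborel (\<lambda>x. gen a \<pi> (\<Gamma>a t) x * \<rho> t x) (- I3)"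
      "has_bochner_integral lborel (\<lambda>x. gen a \<pi> (\<Gamma>z t) x * \<rho> t x) (- I4)"
      using integral_gen_density[OF a \<pi> \<rho>t Ga admG, folded \<phi>_def]
        integral_gen_density[OF a \<pi> \<rho>t Gz admG, folded \<phi>_def] by simp_all
    \<comment> \<open>The factor 1/2 in \<open>Gamma2\<close> and \<open>Gamma2z\<close> matches the
      single \<open>I3\<close> and \<open>I4\<close> left in \<open>lhs\<close>; multiplication by
      -2 gives that sum exactly.\<close>
    have "has_bochner_integral lborel (\<lambda>x. 1/2 * (gen a \<pi> (\<Gamma>a t) x * \<rho> t x)
        - Gamma1 a (gen a \<pi> (\<phi> t)) (\<phi> t) x * \<rho> t x
        + (1/2 * (gen a \<pi> (\<Gamma>z t) x * \<rho> t x) - Gamma1 a (gen z \<pi> (\<phi> t)) (\<phi> t) x * \<rho> t x))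
        (1/2 * (- I3) - I1 + (1/2 * (- I4) - I2))"
      by (intro has_bochner_integral_add has_bochner_integral_diff has_bochner_integral_mult_right LG I1 I2(2))
    then have "(LINT x|lborel. (Gamma2 a \<pi> (\<phi> t) x + Gamma2z a z \<pi> (\<phi> t) x) * \<rho> t x) =
        1/2 * (- I3) - I1 + (1/2 * (- I4) - I2)"
      by (simp add: has_bochner_integral_iff Gamma2_def Gamma2z_def \<Gamma>a_def \<Gamma>z_def algebra_simps)
    then show ?thesis unfolding lhs by simp
  qed
  ultimately show ?thesis by (simp add: \<phi>_def)
qed

end
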